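(* Let $k$ be a non-negative integer and let $p$ be a prime number with $p\equiv 1\pmod 6$. If $B_5\left(\frac{p-1}{3}\right)\equiv 0\pmod 5$, then for every integer $n\ge 0$ satisfying $p\nmid(3n+1)$, $$B_5\left(p^{2k+1}n+\frac{p^{2k+1}-1}{3}\right)\equiv 0\pmod 5.$$
   Context: A partition is called $5$-regular if none of its parts is divisible by $5$. $B_5(n)$ denotes the number of ordered pairs $(\lambda,\mu)$ of $5$-regular partitions such that the sum of all parts of $\lambda$ and $\mu$ equals $n$ (so $B_5(0)=1$); equivalently $\sum_{n\ge 0}B_5(n)q^n=\prod_{k\ge1}\frac{(1-q^{5k})^2}{(1-q^k)^2}$. *)

theory Defs
  imports "HOL-Number_Theory.Number_Theory" "HOL-Library.Multiset"
begin

text \<open>An integer partition is represented by the multiset of its parts, which are positive.\<close>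

definition partition :: "nat multiset \<Rightarrow> bool" where
  "partition \<nu> \<longleftrightarrow> (\<forall>i\<in>#\<nu>. i > 0)"

definition regular_partition :: "nat \<Rightarrow> nat multiset \<Rightarrow> bool" where
  "regular_partition l \<nu> \<longleftrightarrow> partition \<nu> \<and> (\<forall>i\<in>#\<nu>. \<not> l dvd i)"

definition regular_bipartitions :: "nat \<Rightarrow> nat \<Rightarrow> (nat multiset \<times> nat multiset) set" where
  "regular_bipartitions l n =
     {(\<nu>, \<mu>). regular_partition l \<nu> \<and> regular_partition l \<mu> \<and> \<Sum>\<^sub># \<nu> + \<Sum>\<^sub># \<mu> = n}"

definition B :: "nat \<Rightarrow> nat \<Rightarrow> nat" where
  "B l n = card (regular_bipartitions l n)"

lemma finite_partitions_le: "finite {\<nu>. partition \<nu> \<and> \<Sum>\<^sub># \<nu> \<le> n}"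
proof (rule finite_subset)
  show "{\<nu>. partition \<nu> \<and> \<Sum>\<^sub># \<nu> \<le> n} \<subseteq> mset ` {xs. set xs \<subseteq> {..n} \<and> length xs \<le> n}"
  proof
    fix \<nu> assume "\<nu> \<in> {\<nu>. partition \<nu> \<and> \<Sum>\<^sub># \<nu> \<le> n}"
    then have pos: "\<forall>i\<in>#\<nu>. i > 0" and le: "\<Sum>\<^sub># \<nu> \<le> n"
      by (auto simp: partition_def)
    have size: "size \<nu> \<le> \<Sum>\<^sub># \<nu>"
      using pos by (induction \<nu>) auto
    have part: "i \<le> n" if "i \<in># \<nu>" for i
      using le that by (metis le_add1 le_trans multi_member_split sum_mset.add_mset)
    obtain xs where xs: "mset xs = \<nu>" by (metis ex_mset)
    then have "set xs \<subseteq> {..n}" "length xs \<le> n"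
      using size part le by (auto simp flip: xs)
    with xs show "\<nu> \<in> mset ` {xs. set xs \<subseteq> {..n} \<and> length xs \<le> n}" by blast
  qed
  show "finite (mset ` {xs. set xs \<subseteq> {..n} \<and> length xs \<le> n})"
    by (intro finite_imageI finite_lists_length_le) simp
qed

lemma finite_regular_bipartitions: "finite (regular_bipartitions l n)"
  by (rule finite_subset[of _ "{\<nu>. partition \<nu> \<and> \<Sum>\<^sub># \<nu> \<le> n} \<times> {\<nu>. partition \<nu> \<and> \<Sum>\<^sub># \<nu> \<le> n}"])
    (auto simp: regular_bipartitions_def regular_partition_def finite_partitions_le)

lemma B_0: "B l 0 = 1"
proof -
  have "\<nu> = {#}" if "partition \<nu>" "\<Sum>\<^sub># \<nu> = 0" for \<nu>
    using that by (cases \<nu>) (auto simp: partition_def)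
  then have "regular_bipartitions l 0 = {({#}, {#})}"
    by (auto simp: regular_bipartitions_def regular_partition_def partition_def)
  then show ?thesis by (simp add: B_def)
qed

end

theory Submission
  imports Defs "HOL-Computational_Algebra.Computational_Algebra" "HOL-Library.Discrete_Functions"
begin

text \<open>
  Write \<open>f\<^sub>m\<close> for the product of \<open>1 - q\<^sup>m\<^sup>k\<close> over \<open>k \<ge> 1\<close>. Modulo 5 the generating function
  of \<open>B 5\<close> is \<open>f\<^sub>5\<^sup>2 / f\<^sub>1\<^sup>2 \<equiv> f\<^sub>1\<^sup>3 f\<^sub>5\<close>, so by the identities of Jacobi (for \<open>f\<^sub>1\<^sup>3\<close>) and
  Euler (for \<open>f\<^sub>5\<close>) \<open>B 5 n\<close> is congruent to the sum of \<open>(-1)\<^sup>r\<^sup>+\<^sup>s (2r + 1)\<close> over all solutions of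
  \<open>3 (2r + 1)\<^sup>2 + 5 (6s - 1)\<^sup>2 = 8 (3n + 1)\<close>, where \<open>r \<ge> 0\<close>.

  If \<open>p \<equiv> \<plusminus>1 (mod 5)\<close>, then \<open>-15\<close> is a square modulo \<open>p\<close> and \<open>p = u\<^sup>2 + 15 v\<^sup>2\<close>. For \<open>3n + 1 = p\<close>
  every solution is the product of \<open>u \<plusminus> v \<surd>-15\<close> with a solution of \<open>3 X\<^sup>2 + 5 Y\<^sup>2 = 8\<close>; there are
  one or two of them, all of the same weight \<open>\<plusminus>u\<close> modulo 5, so 5 does not divide \<open>B 5 ((p - 1) / 3)\<close>.
  The hypothesis thus forces \<open>p \<equiv> \<plusminus>2 (mod 5)\<close>. Then \<open>-15\<close> is not a square modulo \<open>p\<close>, and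
  \<open>3 x\<^sup>2 + 5 y\<^sup>2\<close> is never exactly divisible by an odd power of \<open>p\<close>: the sum is empty.
\<close>

section \<open>Finite forms of the identities of Euler and Jacobi\<close>

text \<open>Shanks's finite version of Euler's identity. Induction on \<open>n\<close> adds the two
  pentagonal terms of index \<open>n + 1\<close> and \<open>- (n + 1)\<close>. On the left, the
  summand \<open>s = 0\<close> is the truncated Euler product; the others carry powers of
  \<open>q\<close> that exceed \<open>n\<close>.\<close>

lemma shanks_pentagonal:
  fixes q :: "'a::comm_ring_1"
  shows "(\<Sum>s\<le>n. (-1) ^ s * (\<Prod>i\<in>{s<..n}. 1 - q ^ i) * q ^ (s * n + s * (s + 1) div 2)) =
         (\<Sum>s\<in>{- int n..int n}. (-1) ^ nat \<bar>s\<bar> * q ^ nat (s * (3 * s - 1) div 2))"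
proof (induction n)
  case 0
  then show ?case by simp
next
  case (Suc n)
  define P where "P m s = (\<Prod>i\<in>{s<..m}. 1 - q ^ i)" for m s
  \<comment> \<open>From \<open>n\<close> to \<open>n + 1\<close> the summand of index
    \<open>s\<close> changes by the difference of \<open>(-1) ^ s * X s\<close> at
    \<open>s + 1\<close> and at \<open>s\<close>, so the changes telescope. At \<open>s = 0\<close>
    the truncated \<open>s - 1\<close> makes \<open>X 0\<close> spurious; the factor
    \<open>if s = 0 then 0 else 1\<close> removes it.\<close>
  define X where "X s = P n (s - 1) * q ^ (s * Suc n + (s - 1) * s div 2)" for s
  have PS: "P (Suc n) s = (1 - q ^ Suc n) * P n s" if "s \<le> n" for s
  proof -
    have "{s<..Suc n} = insert (Suc n) {s<..n}" using that by auto
    then show ?thesis by (simp add: P_def)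
  qed
  have Pd: "P n (s - 1) = (1 - q ^ s) * P n s" if "1 \<le> s" "s \<le> n" for s
  proof -
    have "{s - 1<..n} = insert s {s<..n}" using that by auto
    then show ?thesis by (simp add: P_def)
  qed
  have tri: "s * (s + 1) div 2 = (s - 1) * s div 2 + s" for s :: nat
    by (cases s) (auto simp: algebra_simps)
  have step: "(-1) ^ s * P (Suc n) s * q ^ (s * Suc n + s * (s + 1) div 2)
     = (-1) ^ s * P n s * q ^ (s * n + s * (s + 1) div 2) + (-1) ^ Suc s * X s * (if s = 0 then 0 else 1)
       - (-1) ^ s * X (Suc s)" if "s \<le> n" for s
  proof (cases "s = 0")
    case True
    then show ?thesis using PS[of 0] by (simp add: X_def algebra_simps)
  next
    case False
    then have "X s = (1 - q ^ s) * P n s * q ^ (s * Suc n + (s - 1) * s div 2)"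
      unfolding X_def using Pd[of s] that by simp
    then have X1: "X s = q ^ (s * n + s * (s + 1) div 2) * P n s - q ^ (s * Suc n + s * (s + 1) div 2) * P n s"
      unfolding tri by (simp add: right_diff_distrib left_diff_distrib power_add mult_ac)
    have X2: "X (Suc s) = P n s * q ^ (s * Suc n + s * (s + 1) div 2) * q ^ Suc n"
      by (simp add: X_def power_add algebra_simps)
    show ?thesis
      unfolding PS[OF that] X1 X2 using False by (simp add: algebra_simps)
  qed
  have tele: "(\<Sum>s\<le>m. (-1) ^ Suc s * X s * (if s = 0 then 0 else 1) - (-1) ^ s * X (Suc s)) = (-1) ^ Suc m * X (Suc m)" for m
    by (induction m) (auto simp: algebra_simps)
  have "(\<Sum>s\<le>Suc n. (-1) ^ s * P (Suc n) s * q ^ (s * Suc n + s * (s + 1) div 2)) =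
     (\<Sum>s\<le>n. (-1) ^ s * P n s * q ^ (s * n + s * (s + 1) div 2)) +
     (\<Sum>s\<le>n. (-1) ^ Suc s * X s * (if s = 0 then 0 else 1) - (-1) ^ s * X (Suc s)) +
     (-1) ^ Suc n * P (Suc n) (Suc n) * q ^ (Suc n * Suc n + Suc n * (Suc n + 1) div 2)"
    unfolding sum.atMost_Suc sum.distrib [symmetric] by (intro arg_cong2[where f = "(+)"] sum.cong refl) (simp only: step atMost_iff add_diff_eq)
  also have "\<dots> = (\<Sum>s\<in>{- int n..int n}. (-1) ^ nat \<bar>s\<bar> * q ^ nat (s * (3 * s - 1) div 2)) +
      (-1) ^ Suc n * q ^ (Suc n * Suc n + n * Suc n div 2) + (-1) ^ Suc n * q ^ (Suc n * Suc n + Suc n * (Suc n + 1) div 2)"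
    using Suc.IH unfolding tele by (simp add: P_def X_def)
  \<comment> \<open>The boundary term of the telescoping sum has index \<open>n + 1\<close>, the new
    summand has index \<open>- (n + 1)\<close>.\<close>
  also have "\<dots> = (\<Sum>s\<in>{- int (Suc n)..int (Suc n)}. (-1) ^ nat \<bar>s\<bar> * q ^ nat (s * (3 * s - 1) div 2))"
  proof -
    define f where "f = (\<lambda>s. (-1) ^ nat \<bar>s\<bar> * q ^ nat (s * (3 * s - 1) div 2))"
    have set: "{- int (Suc n)..int (Suc n)} = insert (int (Suc n)) (insert (- int (Suc n)) {- int n..int n})"
      by auto
    have half: "nat (int (a + b * 2) div 2) = b + a div 2" for a b :: nat
    proof -
      have "int (a + b * 2) div 2 = int ((a + b * 2) div 2)" by (simp only: zdiv_int of_nat_numeral)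
      then show ?thesis by simp
    qed
    have "nat (int (Suc n) * (3 * int (Suc n) - 1) div 2) = Suc n * Suc n + n * Suc n div 2"
    proof -
      have "int (Suc n) * (3 * int (Suc n) - 1) = int (n * Suc n + Suc n * Suc n * 2)" by (simp add: algebra_simps)
      then show ?thesis by (simp only: half)
    qed
    moreover have "nat (- int (Suc n) * (3 * - int (Suc n) - 1) div 2) = Suc n * Suc n + Suc n * (Suc n + 1) div 2"
    proof -
      have "- int (Suc n) * (3 * - int (Suc n) - 1) = int (Suc n * (Suc n + 1) + Suc n * Suc n * 2)" by (simp add: algebra_simps)
      then show ?thesis by (simp only: half)
    qed
    ultimately have f1: "f (int (Suc n)) = (-1) ^ Suc n * q ^ (Suc n * Suc n + n * Suc n div 2)"
      and f2: "f (- int (Suc n)) = (-1) ^ Suc n * q ^ (Suc n * Suc n + Suc n * (Suc n + 1) div 2)"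
      unfolding f_def by (simp_all only: abs_minus_cancel abs_of_nat nat_int)
    have E: "sum f {- int (Suc n)..int (Suc n)} = f (int (Suc n)) + (f (- int (Suc n)) + sum f {- int n..int n})"
      unfolding set by simp
    show ?thesis using E [unfolded f1 f2] unfolding f_def by (simp only: ac_simps)
  qed
  finally show ?case by (simp only: P_def)
qed

section \<open>Gaussian binomials and Jacobi's identity in finite form\<close>

text \<open>Gaussian binomial coefficients, given by a Pascal recurrence so that no quotients of
  \<open>1 - q ^ i\<close> have to be formed.\<close>

fun qbinomial :: "'a::comm_ring_1 \<Rightarrow> nat \<Rightarrow> nat \<Rightarrow> 'a" where
  "qbinomial q n 0 = 1"
| "qbinomial q 0 (Suc k) = 0"
| "qbinomial q (Suc n) (Suc k) = qbinomial q n k + q ^ Suc k * qbinomial q n (Suc k)"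

lemma qbinomial_eq_0: "n < k \<Longrightarrow> qbinomial q n k = 0"
  by (induction q n k rule: qbinomial.induct) auto

lemma qbinomial_self: "qbinomial q n n = 1"
  by (induction n) (auto simp: qbinomial_eq_0)

text \<open>The q-Pochhammer symbol (q; q)_n, that is, the q-factorial without its denominators. At
  \<open>q = fps_X ^ m\<close> it truncates the product \<open>f\<^sub>m\<close>.\<close>

definition qfact :: "'a::comm_ring_1 \<Rightarrow> nat \<Rightarrow> 'a" where
  "qfact q n = (\<Prod>i\<in>{1..n}. 1 - q ^ i)"

lemma qfact_0 [simp]: "qfact q 0 = 1"
  and qfact_Suc: "qfact q (Suc n) = (1 - q ^ Suc n) * qfact q n"
  by (simp_all add: qfact_def)

text \<open>The quotient formula with denominators cleared. By induction both terms of the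
  recurrence become multiples of \<open>qfact q n\<close>, and (1 - a) + a (1 - b) = 1 - a b
  combines them.\<close>

lemma qbinomial_mult_qfact:
  "k \<le> n \<Longrightarrow> qbinomial q n k * qfact q k * qfact q (n - k) = qfact q n"
proof (induction q n k rule: qbinomial.induct)
  case (3 q n k)
  show ?case
  proof (cases "k = n")
    case True
    then show ?thesis by (simp add: qbinomial_self qbinomial_eq_0)
  next
    case False
    define l where "l = n - Suc k"
    have l: "n - k = Suc l" "n - Suc k = l" "n = Suc (k + l)"
      using False 3(3) by (simp_all add: l_def)
    have IH1: "qbinomial q n k * qfact q k * qfact q (Suc l) = qfact q n"
     and IH2: "qbinomial q n (Suc k) * qfact q (Suc k) * qfact q l = qfact q n"
      using 3 l by auto
    have "qbinomial q (Suc n) (Suc k) * qfact q (Suc k) * qfact q (Suc n - Suc k)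
       = (1 - q ^ Suc k) * (qbinomial q n k * qfact q k * qfact q (Suc l)) +
         q ^ Suc k * (1 - q ^ Suc l) * (qbinomial q n (Suc k) * qfact q (Suc k) * qfact q l)"
      using l by (simp add: qfact_Suc algebra_simps)
    also have "\<dots> = (1 - q ^ (Suc k + Suc l)) * qfact q n"
      unfolding IH1 IH2 power_add by (simp add: algebra_simps)
    also have "\<dots> = qfact q (Suc n)" using l by (simp add: qfact_Suc algebra_simps)
    finally show ?thesis .
  qed
qed auto

text \<open>Splitting off the factor \<open>i = 0\<close> leaves the same product with
  \<open>z * q\<close> for \<open>z\<close>. The homogeneous form in \<open>a\<close> and
  \<open>z\<close> allows \<open>a = q ^ n\<close> later, where the usual form would need negative
  powers of \<open>q\<close>.\<close>

lemma q_binomial_theorem: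
  "(\<Prod>i<n. a + z * q ^ i) = (\<Sum>k\<le>n. q ^ (k choose 2) * qbinomial q n k * z ^ k * a ^ (n - k))"
proof (induction n arbitrary: z)
  case 0
  then show ?case by (simp add: binomial_eq_0)
next
  case (Suc n)
  define F where "F k = q ^ (k choose 2) * q ^ k * qbinomial q n k * z ^ k * a ^ (n - k)" for k
  have c2: "Suc k choose 2 = (k choose 2) + k" for k by (simp add: numeral_2_eq_2)
  have "(\<Prod>i<Suc n. a + z * q ^ i) = (a + z) * (\<Prod>i<n. a + (z * q) * q ^ i)"
    by (simp add: prod.lessThan_Suc_shift algebra_simps del: prod.lessThan_Suc)
  also have "\<dots> = (a + z) * (\<Sum>k\<le>n. F k)"
    unfolding Suc.IH F_def by (simp add: algebra_simps power_mult_distrib)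
  also have "\<dots> = a * F 0 + a * (\<Sum>k<n. F (Suc k)) + (\<Sum>k\<le>n. z * F k)"
    by (simp add: algebra_simps sum.atMost_shift flip: sum_distrib_left)
  also have "a * (\<Sum>k<n. F (Suc k)) = (\<Sum>k\<le>n. q ^ (Suc k choose 2) * (q ^ Suc k * qbinomial q n (Suc k)) * z ^ Suc k * a ^ (n - k))"
  proof -
    have "a * (\<Sum>k<n. F (Suc k)) = (\<Sum>k<n. q ^ (Suc k choose 2) * (q ^ Suc k * qbinomial q n (Suc k)) * z ^ Suc k * a ^ (n - k))"
      unfolding sum_distrib_left
    proof (rule sum.cong)
      fix k assume "k \<in> {..<n}"
      then have "a ^ (n - k) = a * a ^ (n - Suc k)" 
        by (metis Suc_diff_Suc lessThan_iff power_Suc)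
      then show "a * F (Suc k) = q ^ (Suc k choose 2) * (q ^ Suc k * qbinomial q n (Suc k)) * z ^ Suc k * a ^ (n - k)"
        by (simp add: F_def algebra_simps)
    qed simp
    \<comment> \<open>The range may include \<open>k = n\<close>, since
      \<open>qbinomial q n (Suc n)\<close> is 0.\<close>
    then show ?thesis by (simp add: qbinomial_eq_0 flip: lessThan_Suc_atMost)
  qed
  also have "(\<Sum>k\<le>n. z * F k) = (\<Sum>k\<le>n. q ^ (Suc k choose 2) * qbinomial q n k * z ^ Suc k * a ^ (n - k))"
    by (intro sum.cong) (auto simp: F_def c2 power_add algebra_simps)
  finally show ?case
    unfolding sum.atMost_Suc_shift by (simp add: F_def sum.distrib algebra_simps)
qed

text \<open>
  By the \<open>q\<close>-binomial theorem, compare the derivatives at \<open>t = 1\<close> of the product of \<open>q\<^sup>n - t q\<^sup>i\<close> over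
  \<open>i \<le> 2n\<close>, whose factor \<open>i = n\<close> vanishes there, and of its expansion in powers of \<open>t\<close>.
\<close>

lemma finite_jacobi:
  fixes q :: "'a::idom"
  assumes "q \<noteq> 0"
  shows "qfact q n ^ 2 =
    (\<Sum>j\<le>n. (-1) ^ j * q ^ (j * (j + 1) div 2) *
       (of_nat (n + 1 + j) * qbinomial q (2 * n + 1) (n + 1 + j) - of_nat (n - j) * qbinomial q (2 * n + 1) (n - j)))"
proof -
  define N where "N = 2 * n + 1"
  \<comment> \<open>\<open>c k\<close> is the coefficient of t^k in the product, and
    \<open>e\<close> is the exponent of the power of \<open>q\<close> that both evaluations share
    and that is cancelled at the end.\<close>
  define c where "c k = (-1) ^ k * q ^ (k choose 2) * qbinomial q N k * q ^ (n * (N - k))" for k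
  define e where "e = n * (n + 1) div 2 + n * n"
  have const: "qbinomial [:q:] m k = [:qbinomial q m k:]" for m k
    by (induction q m k rule: qbinomial.induct) (simp_all add: one_pCons poly_const_pow)
  have "(\<Prod>i<N. [:q ^ n, - (q ^ i):]) = (\<Prod>i<N. [:q:] ^ n + [:0, -1:] * [:q:] ^ i)"
    by (simp add: poly_const_pow)
  also have "\<dots> = (\<Sum>k\<le>N. monom (c k) k)"
    unfolding q_binomial_theorem const
  proof (rule sum.cong)
    fix k
    have "[:0, -1::'a:] = monom (-1) 1" by (simp add: monom_altdef)
    then show "[:q:] ^ (k choose 2) * [:qbinomial q N k:] * [:0, -1:] ^ k * ([:q:] ^ n) ^ (N - k) = monom (c k) k"
      by (simp add: poly_const_pow monom_power c_def smult_monom mult_ac flip: power_mult)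
  qed simp
  finally have "poly (pderiv (\<Prod>i<N. [:q ^ n, - (q ^ i):])) 1 = (\<Sum>k\<le>N. of_nat k * c k)"
    by (simp add: higher_pderiv_sum [of 1, simplified] poly_sum pderiv_monom poly_monom)
  also have "poly (pderiv (\<Prod>i<N. [:q ^ n, - (q ^ i):])) 1 = - (q ^ n) * (\<Prod>i\<in>{..<N} - {n}. q ^ n - q ^ i)"
  proof -
    have "(\<Prod>i<N. [:q ^ n, - (q ^ i):]) = [:q ^ n, - (q ^ n):] * (\<Prod>i\<in>{..<N} - {n}. [:q ^ n, - (q ^ i):])"
      by (rule prod.remove) (auto simp: N_def)
    then show ?thesis by (simp only: pderiv_mult) (simp add: pderiv_pCons poly_prod)
  qed
  also have "(\<Prod>i\<in>{..<N} - {n}. q ^ n - q ^ i) = (\<Prod>i<n. q ^ n - q ^ i) * (\<Prod>i\<in>{n<..<N}. q ^ n - q ^ i)"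
    by (subst prod.union_disjoint [symmetric]) (auto intro!: prod.cong simp: N_def)
  also have "(\<Prod>i<n. q ^ n - q ^ i) = (\<Prod>i<n. - (q ^ i) * (1 - q ^ (n - i)))"
    by (intro prod.cong) (auto simp: algebra_simps simp flip: power_add)
  also have "\<dots> = (-1) ^ n * q ^ (\<Sum>i<n. i) * qfact q n"
  proof -
    have "(\<Prod>i<n. 1 - q ^ (n - i)) = qfact q n"
      unfolding qfact_def by (rule prod.reindex_bij_witness[of _ "\<lambda>i. n - i" "\<lambda>i. n - i"]) auto
    then show ?thesis by (simp add: prod.distrib prod_uminus flip: power_sum)
  qed
  also have "(\<Prod>i\<in>{n<..<N}. q ^ n - q ^ i) = (\<Prod>i\<in>{1..n}. q ^ n * (1 - q ^ i))"
    by (rule prod.reindex_bij_witness[of _ "\<lambda>i. i + n" "\<lambda>i. i - n"])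
       (auto simp: N_def algebra_simps simp flip: power_add)
  also have "\<dots> = q ^ (n * n) * qfact q n"
    by (simp add: prod.distrib qfact_def power_mult)
  also have "- (q ^ n) * ((- 1) ^ n * q ^ (\<Sum>i<n. i) * qfact q n * (q ^ (n * n) * qfact q n)) =
             q ^ e * ((-1) ^ Suc n * qfact q n ^ 2)"
  proof -
    have "e = n + (\<Sum>i<n. i) + n * n"
      unfolding e_def by (induction n) auto
    then show ?thesis by (simp add: power_add power2_eq_square mult_ac)
  qed
  \<comment> \<open>The reflection of \<open>k\<close> to \<open>N - k\<close> exchanges
    \<open>n - j\<close> and \<open>n + 1 + j\<close>. Apart from the Gaussian binomials,
    \<open>c\<close> takes opposite values at these two indices.\<close>
  also have "(\<Sum>k\<le>N. of_nat k * c k) = (\<Sum>k\<le>n. of_nat k * c k) + (\<Sum>k\<in>{n<..N}. of_nat k * c k)"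
  proof -
    have "{..N} = {..n} \<union> {n<..N}" by (auto simp: N_def)
    then show ?thesis by (simp only:) (subst sum.union_disjoint; auto)
  qed
  also have "(\<Sum>k\<le>n. of_nat k * c k) = (\<Sum>j\<le>n. of_nat (n - j) * c (n - j))"
    by (rule sum.reindex_bij_witness[of _ "\<lambda>i. n - i" "\<lambda>i. n - i"]) auto
  also have "(\<Sum>k\<in>{n<..N}. of_nat k * c k) = (\<Sum>j\<le>n. of_nat (n + 1 + j) * c (n + 1 + j))"
    by (rule sum.reindex_bij_witness[of _ "\<lambda>i. n + 1 + i" "\<lambda>i. i - (n + 1)"]) (auto simp: N_def)
  also have "(\<Sum>j\<le>n. of_nat (n - j) * c (n - j)) + (\<Sum>j\<le>n. of_nat (n + 1 + j) * c (n + 1 + j)) = 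
     q ^ e * ((-1) ^ Suc n * (\<Sum>j\<le>n. (-1) ^ j * q ^ (j * (j + 1) div 2) *
       (of_nat (n + 1 + j) * qbinomial q N (n + 1 + j) - of_nat (n - j) * qbinomial q N (n - j))))"
    unfolding sum_distrib_left sum.distrib [symmetric]
  proof (rule sum.cong)
    fix j assume "j \<in> {..n}"
    then obtain i where n: "n = j + i" using le_Suc_ex by auto
    have tri: "2 * (m * (m + 1) div 2) = m * (m + 1)" for m :: nat by simp
    have ch: "2 * (Suc m choose 2) = m * (m + 1)" for m :: nat by (simp add: choose_two)
    have ch': "2 * (m choose 2) + m = m * m" for m :: nat
      using ch[of "m - 1"] by (cases m) auto
    have e: "2 * e = n * (n + 1) + 2 * n * n" unfolding e_def using tri[of n] by simp
    have 1: "((n - j) choose 2) + n * (N - (n - j)) = e + j * (j + 1) div 2"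
      using tri[of j] ch'[of i] e by (simp add: n N_def algebra_simps)
    have 2: "((n + 1 + j) choose 2) + n * (N - (n + 1 + j)) = e + j * (j + 1) div 2"
      using tri[of j] ch'[of "n + 1 + j"] e by (simp add: n N_def algebra_simps)
    have s: "(-1) ^ (n - j) = ((-1) ^ (n + j) :: 'a)" by (simp add: n power_add flip: power_mult_distrib)
    have c1: "c (n - j) = (-1) ^ (n + j) * qbinomial q N (n - j) * q ^ (e + j * (j + 1) div 2)"
      unfolding c_def 1[symmetric] s by (simp add: power_add mult_ac)
    have c2: "c (n + 1 + j) = - ((-1) ^ (n + j)) * qbinomial q N (n + 1 + j) * q ^ (e + j * (j + 1) div 2)"
      unfolding c_def 2[symmetric] by (simp add: power_add mult_ac)
    show "of_nat (n - j) * c (n - j) + of_nat (n + 1 + j) * c (n + 1 + j) =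
      q ^ e * ((-1) ^ Suc n * ((-1) ^ j * q ^ (j * (j + 1) div 2) *
       (of_nat (n + 1 + j) * qbinomial q N (n + 1 + j) - of_nat (n - j) * qbinomial q N (n - j))))"
      unfolding c1 c2 power_add power_Suc by (simp add: algebra_simps del: of_nat_add)
  qed simp
  finally have "(-1) ^ Suc n * qfact q n ^ 2 = (-1) ^ Suc n * (\<Sum>j\<le>n. (-1) ^ j * q ^ (j * (j + 1) div 2) *
       (of_nat (n + 1 + j) * qbinomial q N (n + 1 + j) - of_nat (n - j) * qbinomial q N (n - j)))"
    using assms by (simp only: mult_cancel_left power_eq_0_iff) auto
  then show ?thesis by (simp add: N_def)
qed

section \<open>Generating functions\<close>

definition partitions_with :: "nat set \<Rightarrow> nat \<Rightarrow> nat multiset set" where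
  "partitions_with A n = {\<nu>. set_mset \<nu> \<subseteq> A \<and> \<Sum>\<^sub># \<nu> = n}"

definition partition_fps :: "nat set \<Rightarrow> int fps" where
  "partition_fps A = Abs_fps (\<lambda>n. int (card (partitions_with A n)))"

lemma finite_partitions_with:
  assumes "0 \<notin> A"
  shows "finite (partitions_with A n)"
proof (rule finite_subset)
  show "partitions_with A n \<subseteq> mset ` {xs. set xs \<subseteq> {..n} \<and> length xs \<le> n}"
  proof
    fix \<nu> assume \<nu>: "\<nu> \<in> partitions_with A n"
    obtain xs where xs: "mset xs = \<nu>" by (metis ex_mset)
    have "\<forall>i\<in>#\<nu>. i > 0" using \<nu> assms by (auto simp: partitions_with_def intro: gr0I)
    then have "size \<nu> \<le> \<Sum>\<^sub># \<nu>" by (induction \<nu>) auto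
    moreover have "i \<le> n" if "i \<in># \<nu>" for i
      using \<nu> that by (auto simp: partitions_with_def dest!: multi_member_split)
    ultimately have "set xs \<subseteq> {..n}" "length xs \<le> n"
      using \<nu> by (auto simp: partitions_with_def simp flip: xs)
    with xs show "\<nu> \<in> mset ` {xs. set xs \<subseteq> {..n} \<and> length xs \<le> n}" by blast
  qed
qed (intro finite_imageI finite_lists_length_le, simp)

text \<open>A partition either avoids the part \<open>a\<close> or arises by adding one copy of
  \<open>a\<close> to a partition of \<open>n - a\<close> with the same allowed parts.\<close>

lemma partition_fps_insert:
  assumes "a \<notin> A" "0 \<notin> insert a A"
  shows "(1 - fps_X ^ a) * partition_fps (insert a A) = partition_fps A"
proof (rule fps_ext)
  fix n
  have decomp: "partitions_with (insert a A) n =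
    partitions_with A n \<union> (if a \<le> n then add_mset a ` partitions_with (insert a A) (n - a) else {})"
  proof (intro equalityI subsetI)
    fix \<nu> assume \<nu>: "\<nu> \<in> partitions_with (insert a A) n"
    show "\<nu> \<in> partitions_with A n \<union> (if a \<le> n then add_mset a ` partitions_with (insert a A) (n - a) else {})"
    proof (cases "a \<in># \<nu>")
      case True
      then obtain \<mu> where \<mu>: "\<nu> = add_mset a \<mu>" by (meson multi_member_split)
      with \<nu> have "a \<le> n" "\<mu> \<in> partitions_with (insert a A) (n - a)"
        by (auto simp: partitions_with_def)
      with \<mu> show ?thesis by auto
    qed (use \<nu> in \<open>auto simp: partitions_with_def\<close>)
  qed (auto simp: partitions_with_def split: if_splits)
  have "card (partitions_with (insert a A) n) =
    card (partitions_with A n) + (if a \<le> n then card (partitions_with (insert a A) (n - a)) else 0)"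
  proof (cases "a \<le> n")
    case True
    have "card (partitions_with A n \<union> add_mset a ` partitions_with (insert a A) (n - a)) =
      card (partitions_with A n) + card (add_mset a ` partitions_with (insert a A) (n - a))"
    proof (rule card_Un_disjoint)
      show "finite (partitions_with A n)" "finite (add_mset a ` partitions_with (insert a A) (n - a))"
        using assms by (simp_all add: finite_partitions_with)
      have "a \<notin># \<nu>" if "\<nu> \<in> partitions_with A n" for \<nu>
        using that assms(1) by (auto simp: partitions_with_def)
      then show "partitions_with A n \<inter> add_mset a ` partitions_with (insert a A) (n - a) = {}"
        by force
    qed
    then show ?thesis using True by (subst decomp) (simp add: card_image inj_on_def)
  qed (subst decomp, simp)
  then show "fps_nth ((1 - fps_X ^ a) * partition_fps (insert a A)) n = fps_nth (partition_fps A) n"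
    by (simp add: partition_fps_def left_diff_distrib fps_X_power_mult_nth)
qed

lemma partition_fps_mult_prod:
  assumes "finite A" "0 \<notin> A"
  shows "(\<Prod>a\<in>A. 1 - fps_X ^ a) * partition_fps A = 1"
  using assms
proof (induction A rule: finite_induct)
  case empty
  have "partitions_with {} n = (if n = 0 then {{#}} else {})" for n
    by (auto simp: partitions_with_def)
  then show ?case by (auto simp: partition_fps_def fps_eq_iff)
next
  case (insert a A)
  have "(\<Prod>a\<in>insert a A. 1 - fps_X ^ a) * partition_fps (insert a A) =
      (\<Prod>a\<in>A. 1 - fps_X ^ a) * ((1 - fps_X ^ a) * partition_fps (insert a A))"
    using insert.hyps by (simp add: mult_ac)
  also have "\<dots> = 1"
    using insert partition_fps_insert[of a A] by simp
  finally show ?case .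
qed

text \<open>No part exceeds \<open>n\<close>, so parts may be restricted to \<open>{1..N}\<close>,
  which keeps all products finite. Sorting bipartitions by the size of the first component gives the
  Cauchy product.\<close>

lemma B_conv_partition_fps:
  assumes "n \<le> N"
  shows "int (B l n) = fps_nth (partition_fps {i\<in>{1..N}. \<not> l dvd i} ^ 2) n"
proof -
  define A where "A = {i\<in>{1..N}. \<not> l dvd i}"
  have iff: "regular_partition l \<nu> \<longleftrightarrow> set_mset \<nu> \<subseteq> A" if "\<Sum>\<^sub># \<nu> \<le> N" for \<nu>
  proof -
    have "i \<le> N" if "i \<in># \<nu>" for i
      using that \<open>\<Sum>\<^sub># \<nu> \<le> N\<close> by (auto dest!: multi_member_split)
    then show ?thesis
      by (auto simp: regular_partition_def partition_def A_def Suc_le_eq)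
  qed
  have "regular_bipartitions l n = (\<Union>i\<in>{0..n}. partitions_with A i \<times> partitions_with A (n - i))"
  proof (intro equalityI subsetI)
    fix x assume "x \<in> regular_bipartitions l n"
    then obtain \<nu> \<mu> where x: "x = (\<nu>, \<mu>)" "regular_partition l \<nu>" "regular_partition l \<mu>" "\<Sum>\<^sub># \<nu> + \<Sum>\<^sub># \<mu> = n"
      by (auto simp: regular_bipartitions_def)
    then have "x \<in> partitions_with A (\<Sum>\<^sub># \<nu>) \<times> partitions_with A (n - \<Sum>\<^sub># \<nu>)"
      using iff[of \<nu>] iff[of \<mu>] assms by (auto simp: partitions_with_def)
    moreover have "\<Sum>\<^sub># \<nu> \<in> {0..n}" using x by auto
    ultimately show "x \<in> (\<Union>i\<in>{0..n}. partitions_with A i \<times> partitions_with A (n - i))" by blast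
  next
    fix x assume "x \<in> (\<Union>i\<in>{0..n}. partitions_with A i \<times> partitions_with A (n - i))"
    then obtain \<nu> \<mu> where x: "x = (\<nu>, \<mu>)" "set_mset \<nu> \<subseteq> A" "set_mset \<mu> \<subseteq> A" "\<Sum>\<^sub># \<nu> + \<Sum>\<^sub># \<mu> = n"
      by (auto simp: partitions_with_def)
    then show "x \<in> regular_bipartitions l n"
      using iff[of \<nu>] iff[of \<mu>] assms by (auto simp: regular_bipartitions_def)
  qed
  then have "B l n = (\<Sum>i=0..n. card (partitions_with A i \<times> partitions_with A (n - i)))"
    unfolding B_def
    by (simp only:) (subst card_UN_disjoint,
      auto simp: A_def finite_partitions_with, auto simp: partitions_with_def)
  then show ?thesis
    by (simp add: power2_eq_square fps_mult_nth partition_fps_def A_def card_cartesian_product)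
qed

section \<open>Congruences of truncated power series\<close>

text \<open>Equality modulo \<open>m\<close> and modulo \<open>fps_X ^ n\<close> at once: finite
  products can then stand in for the infinite ones.\<close>

definition fps_cong :: "int \<Rightarrow> nat \<Rightarrow> int fps \<Rightarrow> int fps \<Rightarrow> bool" where
  "fps_cong m n f g \<longleftrightarrow> (\<forall>i<n. [fps_nth f i = fps_nth g i] (mod m))"

lemma fps_cong_refl [simp, intro]: "fps_cong m n f f"
  by (simp add: fps_cong_def)

lemma fps_cong_sym: "fps_cong m n f g \<Longrightarrow> fps_cong m n g f"
  by (auto simp: fps_cong_def intro: cong_sym)

lemma fps_cong_trans [trans]: "fps_cong m n f g \<Longrightarrow> fps_cong m n g h \<Longrightarrow> fps_cong m n f h"
  by (auto simp: fps_cong_def intro: cong_trans)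

lemma fps_cong_add: "fps_cong m n f g \<Longrightarrow> fps_cong m n f' g' \<Longrightarrow> fps_cong m n (f + f') (g + g')"
  by (simp add: fps_cong_def cong_add)

lemma fps_cong_sum: "(\<And>x. x \<in> A \<Longrightarrow> fps_cong m n (f x) (g x)) \<Longrightarrow> fps_cong m n (sum f A) (sum g A)"
  by (simp add: fps_cong_def fps_sum_nth cong_sum)

lemma fps_cong_mult: "fps_cong m n f g \<Longrightarrow> fps_cong m n f' g' \<Longrightarrow> fps_cong m n (f * f') (g * g')"
  by (auto simp: fps_cong_def fps_mult_nth intro!: cong_sum cong_mult)

lemma fps_cong_power: "fps_cong m n f g \<Longrightarrow> fps_cong m n (f ^ k) (g ^ k)"
  by (induction k) (auto intro: fps_cong_mult)

lemma fps_cong_prod: "(\<And>x. x \<in> A \<Longrightarrow> fps_cong m n (f x) (g x)) \<Longrightarrow> fps_cong m n (prod f A) (prod g A)"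
  by (induction A rule: infinite_finite_induct) (auto intro: fps_cong_mult)

text \<open>A power series with constant term 1 is invertible over the integers.\<close>

lemma fps_cong_mult_left_cancel:
  assumes "fps_cong m n (h * f) (h * g)" "fps_nth h 0 = 1"
  shows "fps_cong m n f g"
proof -
  have "fps_right_inverse h 1 * h = 1"
    using fps_right_inverse[of h 1] assms(2) by (simp add: mult.commute)
  with fps_cong_mult[OF fps_cong_refl[of m n "fps_right_inverse h 1"] assms(1)]
  show ?thesis by (simp add: mult.assoc [symmetric])
qed

lemma fps_cong_X_power_mult: "n \<le> k \<Longrightarrow> fps_cong m n (fps_X ^ k * f) 0"
  by (auto simp: fps_cong_def fps_X_power_mult_nth)

lemma fps_cong_const_multiple: "fps_cong m n (f + fps_const m * g) f"
  by (auto simp: fps_cong_def cong_iff_dvd_diff)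

lemma qfact_fps_nth_0 [simp]:
  assumes "a > 0"
  shows "fps_nth (qfact (fps_X ^ a) n :: int fps) 0 = 1"
  using assms by (induction n) (simp_all add: qfact_Suc fps_power_zeroth power_0_left del: power_Suc)

text \<open>The additional factors \<open>1 - fps_X ^ (a * i)\<close> with \<open>i > m\<close> are
  1 up to terms of degree at least \<open>a * (m + 1)\<close>.\<close>

lemma qfact_fps_cong:
  assumes "m \<le> n" "k \<le> a * (m + 1)"
  shows "fps_cong c k (qfact (fps_X ^ a) n) (qfact (fps_X ^ a) m)"
  using assms(1)
proof (induction n rule: dec_induct)
  case (step n)
  have "k \<le> a * Suc n"
    by (rule order_trans[OF assms(2) mult_le_mono2]) (use step(1) in simp)
  then have "fps_cong c k ((fps_X ^ a) ^ Suc n * qfact (fps_X ^ a) n) 0"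
    unfolding power_mult [symmetric] by (rule fps_cong_X_power_mult)
  then have "fps_cong c k (qfact (fps_X ^ a) (Suc n)) (qfact (fps_X ^ a) n)"
    by (simp add: fps_cong_def qfact_Suc left_diff_distrib cong_iff_dvd_diff del: power_Suc)
  then show ?case using step.IH by (rule fps_cong_trans)
qed simp

text \<open>Frobenius modulo 5, applied to each factor: (1 - y)^5 and 1 - y^5 differ by a multiple
  of 5.\<close>

lemma qfact_power_5_cong: "fps_cong 5 k (qfact fps_X n ^ 5) (qfact (fps_X ^ 5) n)"
proof -
  have "fps_cong 5 k ((1 - fps_X ^ i) ^ 5) (1 - (fps_X ^ 5) ^ i)" for i
  proof -
    define y :: "int fps" where "y = fps_X ^ i"
    have "(1 - y) ^ 5 = (1 - y ^ 5) + fps_const 5 * (- y + 2 * y ^ 2 - 2 * y ^ 3 + y ^ 4)"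
      unfolding numeral_fps_const [symmetric] by (simp add: eval_nat_numeral algebra_simps)
    then have "fps_cong 5 k ((1 - y) ^ 5) (1 - y ^ 5)"
      by (simp only: fps_cong_const_multiple)
    moreover have "y ^ 5 = (fps_X ^ 5) ^ i" unfolding y_def by (simp only: power_mult [symmetric] mult.commute)
    ultimately show ?thesis by (simp only: y_def)
  qed
  then show ?thesis unfolding qfact_def prod_power_distrib by (intro fps_cong_prod)
qed

lemma fps_minus_one_power: "(-1) ^ k = fps_const ((-1) ^ k :: int)"
proof -
  have "- 1 = fps_const (- 1 :: int)"
    by (metis fps_const_neg fps_const_1_eq_1)
  then show ?thesis by (simp only: fps_const_power)
qed

text \<open>In \<open>shanks_pentagonal\<close> at \<open>q = fps_X ^ a\<close> every summand with
  \<open>s \<ge> 1\<close> has order at least \<open>n + 1\<close>, so only \<open>s = 0\<close>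
  survives.\<close>

lemma euler_pentagonal_cong:
  assumes "a > 0"
  shows "fps_cong c (Suc n) (qfact (fps_X ^ a) n)
    (\<Sum>s\<in>{- int n..int n}. fps_const ((-1) ^ nat \<bar>s\<bar>) * fps_X ^ (a * nat (s * (3 * s - 1) div 2)))"
proof -
  define q :: "int fps" where "q = fps_X ^ a"
  define t where "t s = (-1) ^ s * (\<Prod>i\<in>{s<..n}. 1 - q ^ i) * q ^ (s * n + s * (s + 1) div 2)" for s
  have "fps_cong c (Suc n) (t s) (if s = 0 then qfact q n else 0)" for s
  proof (cases "s = 0")
    case True
    have "{0<..n} = {1..n}" by auto
    with True show ?thesis by (simp add: t_def qfact_def)
  next
    case False
    have "Suc n \<le> a * (s * n + s * (s + 1) div 2)"
    proof -
      have "1 * n \<le> s * n" "2 \<le> s * (s + 1)" using False mult_le_mono[of 1 s 2 "s + 1"] by auto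
      then have "Suc n \<le> s * n + s * (s + 1) div 2" by linarith
      also have "\<dots> \<le> a * \<dots>" using assms by simp
      finally show ?thesis .
    qed
    then have "fps_cong c (Suc n) (fps_X ^ (a * (s * n + s * (s + 1) div 2)) * ((-1) ^ s * (\<Prod>i\<in>{s<..n}. 1 - q ^ i))) 0"
      by (rule fps_cong_X_power_mult)
    then show ?thesis using False unfolding t_def q_def by (simp only: power_mult mult_ac if_False)
  qed
  then have "fps_cong c (Suc n) (\<Sum>s\<le>n. t s) (\<Sum>s\<le>n. if s = 0 then qfact q n else 0)"
    by (intro fps_cong_sum)
  moreover have "(\<Sum>s\<le>n. t s) = (\<Sum>s\<in>{- int n..int n}. (-1) ^ nat \<bar>s\<bar> * q ^ nat (s * (3 * s - 1) div 2))"
    unfolding t_def by (rule shanks_pentagonal)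
  moreover have "(\<Sum>s\<le>n. if s = 0 then qfact q n else 0) = qfact q n"
    by (simp only: sum.delta finite_atMost atMost_iff) simp
  ultimately have "fps_cong c (Suc n) (\<Sum>s\<in>{- int n..int n}. (-1) ^ nat \<bar>s\<bar> * q ^ nat (s * (3 * s - 1) div 2)) (qfact q n)"
    by (simp only:)
  from fps_cong_sym[OF this] show ?thesis
    by (simp only: q_def power_mult [symmetric] fps_minus_one_power)
qed

text \<open>As \<open>k\<close> and \<open>m - k\<close> are both at least \<open>n\<close>, all the
  q-factorials in the quotient formula agree with \<open>qfact fps_X n\<close> up to degree
  \<open>n\<close>; one of them can be cancelled.\<close>

lemma qbinomial_mult_qfact_cong:
  assumes "n \<le> k" "n + k \<le> m"
  shows "fps_cong c (Suc n) (qbinomial fps_X m k * qfact fps_X n) 1"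
proof -
  let ?E = "qfact fps_X :: nat \<Rightarrow> int fps"
  have E: "fps_cong c (Suc n) (?E i) (?E n)" if "n \<le> i" for i
    using qfact_fps_cong[of n i "Suc n" 1] that by simp
  have "fps_cong c (Suc n) (?E n * (qbinomial fps_X m k * ?E n)) (qbinomial fps_X m k * ?E k * ?E (m - k))"
    unfolding mult.commute[of "?E n" "qbinomial fps_X m k * ?E n"]
    using assms by (intro fps_cong_mult fps_cong_refl fps_cong_sym[OF E]) auto
  also have "qbinomial fps_X m k * ?E k * ?E (m - k) = ?E m"
    using assms by (intro qbinomial_mult_qfact) simp
  also have "fps_cong c (Suc n) (?E m) (?E n * 1)"
    using E[of m] assms by simp
  finally show ?thesis
    by (rule fps_cong_mult_left_cancel) (use qfact_fps_nth_0[of 1 n] in simp)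
qed

text \<open>Multiply \<open>finite_jacobi\<close> for \<open>N = 2 n\<close> by
  \<open>qfact fps_X n\<close>. For \<open>j \<le> n\<close> both Gaussian binomials then become 1
  and leave the coefficient (N + 1 + j) - (N - j) = 2 j + 1; this is where \<open>2 n\<close> is
  large enough. For \<open>j > n\<close> the exponent j (j + 1) / 2 exceeds
  \<open>n\<close>.\<close>

lemma jacobi_cong:
  "fps_cong c (Suc n) (qfact fps_X n ^ 3) (\<Sum>j\<le>n. fps_const ((-1) ^ j * (2 * int j + 1)) * fps_X ^ (j * (j + 1) div 2))"
proof -
  define N where "N = 2 * n"
  let ?E = "qfact fps_X :: nat \<Rightarrow> int fps" and ?G = "qbinomial (fps_X :: int fps) (2 * N + 1)"
  define t where "t j = (-1) ^ j * fps_X ^ (j * (j + 1) div 2) *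
       (of_nat (N + 1 + j) * ?G (N + 1 + j) - of_nat (N - j) * ?G (N - j)) * ?E n" for j
  define u where "u j = fps_const ((-1) ^ j * (2 * int j + 1)) * fps_X ^ (j * (j + 1) div 2)" for j
  have "fps_cong c (Suc n) (?E n ^ 3) (?E N ^ 2 * ?E n)"
    unfolding eval_nat_numeral power_Suc2 power_0 mult_1_left
    using qfact_fps_cong[of n N "Suc n" 1] by (intro fps_cong_mult fps_cong_refl) (auto simp: N_def intro: fps_cong_sym)
  also have "?E N ^ 2 * ?E n = (\<Sum>j\<le>N. t j)"
    unfolding t_def by (subst finite_jacobi) (simp_all add: sum_distrib_right)
  also have "fps_cong c (Suc n) (\<Sum>j\<le>N. t j) (\<Sum>j\<le>N. if j \<le> n then u j else 0)"
  proof (rule fps_cong_sum)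
    fix j assume "j \<in> {..N}"
    show "fps_cong c (Suc n) (t j) (if j \<le> n then u j else 0)"
    proof (cases "j \<le> n")
      case True
      have "fps_cong c (Suc n) (?G (N + 1 + j) * ?E n) 1" "fps_cong c (Suc n) (?G (N - j) * ?E n) 1"
        using True by (intro qbinomial_mult_qfact_cong; simp add: N_def)+
      then have "fps_cong c (Suc n)
         ((-1) ^ j * fps_X ^ (j * (j + 1) div 2) * (of_nat (N + 1 + j) * (?G (N + 1 + j) * ?E n) + (- of_nat (N - j)) * (?G (N - j) * ?E n)))
         ((-1) ^ j * fps_X ^ (j * (j + 1) div 2) * (of_nat (N + 1 + j) * 1 + (- of_nat (N - j)) * 1))"
        by (intro fps_cong_mult fps_cong_add fps_cong_refl)
      moreover have "x * (a * g - b * h) * e = x * (a * (g * e) + (- b) * (h * e))" for x a g b h e :: "int fps"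
        by (simp add: algebra_simps)
      then have "t j = (-1) ^ j * fps_X ^ (j * (j + 1) div 2) * (of_nat (N + 1 + j) * (?G (N + 1 + j) * ?E n) + (- of_nat (N - j)) * (?G (N - j) * ?E n))"
        unfolding t_def .
      moreover have "(-1) ^ j * fps_X ^ (j * (j + 1) div 2) * (of_nat (N + 1 + j) * 1 + (- of_nat (N - j)) * 1) = u j"
      proof -
        have "of_nat (N + 1 + j) * 1 + (- of_nat (N - j)) * 1 = fps_const (2 * int j + 1)"
          using True by (simp add: N_def of_nat_diff fps_of_nat [symmetric] fps_eq_iff)
        then show ?thesis
          unfolding u_def by (simp only: fps_minus_one_power fps_const_mult [symmetric] mult_ac)
      qed
      ultimately show ?thesis using True by (simp only: if_True)
    next
      case False
      have "2 * Suc n \<le> j * (j + 1)" using False mult_le_mono[of "Suc n" j 2 "j + 1"] by auto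
      then have "Suc n \<le> j * (j + 1) div 2" using div_le_mono[of "2 * Suc n" _ 2] by simp
      then have "fps_cong c (Suc n) (fps_X ^ (j * (j + 1) div 2) * ((-1) ^ j *
       (of_nat (N + 1 + j) * ?G (N + 1 + j) - of_nat (N - j) * ?G (N - j)) * ?E n)) 0"
        by (rule fps_cong_X_power_mult)
      moreover have "x * y * z * e = y * (x * z * e)" for x y z e :: "int fps"
        by (simp add: mult_ac)
      ultimately show ?thesis using False unfolding t_def by (simp only: if_False)
    qed
  qed
  also have "(\<Sum>j\<le>N. if j \<le> n then u j else 0) = (\<Sum>j\<le>n. u j)"
    by (intro sum.mono_neutral_cong_right) (auto simp: N_def)
  finally show ?thesis by (simp only: u_def)
qed

section \<open>The generating function modulo 5 and its coefficients\<close>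

lemma prod_not_multiples_mult_qfact:
  assumes "l > 0"
  shows "(\<Prod>a\<in>{i\<in>{1..l * M}. \<not> l dvd i}. 1 - fps_X ^ a) * qfact (fps_X ^ l) M = (qfact fps_X (l * M) :: int fps)"
proof -
  have "qfact (fps_X ^ l) M = (\<Prod>a\<in>{i\<in>{1..l * M}. l dvd i}. 1 - (fps_X :: int fps) ^ a)"
    unfolding qfact_def power_mult [symmetric]
    by (rule prod.reindex_bij_witness[of _ "\<lambda>i. i div l" "\<lambda>i. l * i"]) (use assms in \<open>auto elim!: dvdE simp: Suc_le_eq\<close>)
  moreover have "{1..l * M} = {i\<in>{1..l * M}. \<not> l dvd i} \<union> {i\<in>{1..l * M}. l dvd i}" by auto
  then have "qfact fps_X (l * M) = (\<Prod>a\<in>{i\<in>{1..l * M}. \<not> l dvd i} \<union> {i\<in>{1..l * M}. l dvd i}. 1 - (fps_X :: int fps) ^ a)"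
    unfolding qfact_def by (rule arg_cong)
  then have "qfact fps_X (l * M) = (\<Prod>a\<in>{i\<in>{1..l * M}. \<not> l dvd i}. 1 - (fps_X :: int fps) ^ a) *
      (\<Prod>a\<in>{i\<in>{1..l * M}. l dvd i}. 1 - fps_X ^ a)"
    by (simp only:) (rule prod.union_disjoint, auto)
  ultimately show ?thesis by simp
qed

text \<open>With \<open>P\<close> the partition series, \<open>f\<^sub>1 P = f\<^sub>5\<close>, so
  \<open>f\<^sub>1\<^sup>2 P\<^sup>2 = f\<^sub>5\<^sup>2\<close>; one factor
  \<open>f\<^sub>5\<close> is replaced by \<open>f\<^sub>1\<^sup>5\<close> and
  \<open>f\<^sub>1\<^sup>2\<close> is cancelled. Taking \<open>N\<close> to be \<open>5 * M\<close>
  makes the multiples of 5 up to \<open>N\<close> exactly the indices of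
  \<open>qfact (fps_X ^ 5) M\<close>.\<close>

lemma partition_fps_5_regular_cong:
  fixes M :: nat
  defines "N \<equiv> 5 * M"
  shows "fps_cong 5 (Suc N) (partition_fps {i\<in>{1..N}. \<not> 5 dvd i} ^ 2) (qfact fps_X N ^ 3 * qfact (fps_X ^ 5) N)"
proof -
  let ?P = "partition_fps {i\<in>{1..N}. \<not> 5 dvd i}" and ?E = "qfact fps_X N :: int fps" and ?F = "qfact (fps_X ^ 5) N :: int fps"
  let ?D = "\<Prod>a\<in>{i\<in>{1..N}. \<not> 5 dvd i}. 1 - fps_X ^ a :: int fps"
  have "?D * ?P = 1"
    by (rule partition_fps_mult_prod) auto
  moreover have E: "?D * qfact (fps_X ^ 5) M = ?E"
    unfolding N_def by (rule prod_not_multiples_mult_qfact) simp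
  have "?E * ?P = (?D * ?P) * qfact (fps_X ^ 5) M"
    unfolding E [symmetric] by (simp only: mult_ac)
  ultimately have "?E * ?P = qfact (fps_X ^ 5) M" by simp
  then have EP: "fps_cong 5 (Suc N) (?E * ?P) ?F"
    using qfact_fps_cong[of M N "Suc N" 5] by (simp add: N_def fps_cong_sym)
  have "fps_cong 5 (Suc N) (?E ^ 2 * ?P ^ 2) (?F ^ 2)"
    using fps_cong_power[OF EP, of 2] by (simp only: power_mult_distrib)
  also have "fps_cong 5 (Suc N) (?F ^ 2) (?F * ?E ^ 5)"
    unfolding power2_eq_square by (intro fps_cong_mult fps_cong_refl fps_cong_sym[OF qfact_power_5_cong])
  also have "?F * ?E ^ 5 = ?E ^ 2 * (?E ^ 3 * ?F)"
    by (simp add: mult_ac flip: power_add)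
  finally show ?thesis
    by (rule fps_cong_mult_left_cancel) (use qfact_fps_nth_0[of 1 N] in \<open>simp add: fps_power_zeroth\<close>)
qed

text \<open>The equation is \<open>r(r + 1)/2 + 5 s(3s - 1)/2 = n\<close>, multiplied by 24 with the squares completed.\<close>

definition theta_pairs :: "nat \<Rightarrow> (nat \<times> int) set" where
  "theta_pairs n = {(r, s). 3 * (2 * int r + 1) ^ 2 + 5 * (6 * s - 1) ^ 2 = 8 * (3 * int n + 1)}"

text \<open>Links the quadratic equation to the exponents in the two series. The use of
  \<open>nat\<close> is harmless because generalized pentagonal numbers are nonnegative.\<close>

lemma theta_pairs_conv:
  "(r, s) \<in> theta_pairs n \<longleftrightarrow> r * (r + 1) div 2 + 5 * nat (s * (3 * s - 1) div 2) = n"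
proof -
  define e where "e = r * (r + 1) div 2"
  define f where "f = s * (3 * s - 1) div 2"
  have "2 * e = r * (r + 1)" by (simp add: e_def)
  then have "2 * int e = int r * (int r + 1)" by (metis of_nat_1 of_nat_add of_nat_mult of_nat_numeral)
  moreover have f: "2 * f = s * (3 * s - 1)" by (simp add: f_def)
  ultimately have "3 * (2 * int r + 1) ^ 2 + 5 * (6 * s - 1) ^ 2 = 24 * (int e + 5 * f) + 8"
    by (simp add: power2_eq_square algebra_simps)
  moreover have "f \<ge> 0"
  proof -
    have "s * (3 * s - 1) \<ge> 0" by (cases "s \<ge> 1") (auto intro: mult_nonpos_nonpos)
    then show ?thesis using f by linarith
  qed
  ultimately show ?thesis
    unfolding theta_pairs_def e_def [symmetric] f_def [symmetric] by auto
qed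

text \<open>Ensures that the truncated series contain the terms of all solutions.\<close>

lemma theta_pairs_subset: "theta_pairs n \<subseteq> {..n} \<times> {- int n..int n}"
proof -
  have "r \<in> {..n} \<and> s \<in> {- int n..int n}" if "(r, s) \<in> theta_pairs n" for r s
  proof -
    have eq: "3 * (2 * int r + 1) ^ 2 + 5 * (6 * s - 1) ^ 2 = 8 * (3 * int n + 1)"
      using that by (simp add: theta_pairs_def)
    have "int r \<le> int r * int r" by (cases r) auto
    moreover have "\<bar>s\<bar> \<le> s * s"
      using self_le_power[of "\<bar>s\<bar>" 2] by (cases "s = 0") (auto simp: power2_eq_square)
    moreover have "12 * (int r * int r) + 12 * int r + 180 * (s * s) - 60 * s = 24 * int n"
      using eq by (simp add: power2_eq_square algebra_simps)
    moreover have "0 \<le> int r * int r" "0 \<le> s * s" by simp_all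
    ultimately have "int r \<le> int n" "\<bar>s\<bar> \<le> int n" by linarith+
    then show ?thesis by auto
  qed
  then show ?thesis by auto
qed

lemma finite_theta_pairs: "finite (theta_pairs n)"
  by (rule finite_subset[OF theta_pairs_subset]) simp

lemma B_5_cong:
  "[int (B 5 n) = (\<Sum>(r, s)\<in>theta_pairs n. (-1) ^ (r + nat \<bar>s\<bar>) * (2 * int r + 1))] (mod 5)"
proof -
  \<comment> \<open>A multiple of 5 that is at least \<open>n\<close>, as the reduction modulo 5
    requires.\<close>
  define N where "N = 5 * n"
  define a :: "nat \<Rightarrow> int" where "a r = (-1) ^ r * (2 * int r + 1)" for r
  define b :: "int \<Rightarrow> int" where "b s = (-1) ^ nat \<bar>s\<bar>" for s
  define e :: "nat \<Rightarrow> nat" where "e r = r * (r + 1) div 2" for r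
  define f :: "int \<Rightarrow> nat" where "f s = 5 * nat (s * (3 * s - 1) div 2)" for s
  have conv: "e r + f s = n \<longleftrightarrow> (r, s) \<in> theta_pairs n" for r s
    unfolding e_def f_def by (simp only: theta_pairs_conv)
  let ?S = "{..N} \<times> {- int N..int N}"
  let ?T = "(\<Sum>r\<le>N. fps_const (a r) * fps_X ^ e r) * (\<Sum>s\<in>{- int N..int N}. fps_const (b s) * fps_X ^ f s)"
  have "fps_cong 5 (Suc N) (qfact fps_X N ^ 3 * qfact (fps_X ^ 5) N) ?T"
    unfolding a_def b_def e_def f_def by (intro fps_cong_mult jacobi_cong euler_pentagonal_cong) simp
  with partition_fps_5_regular_cong[of n]
  have "fps_cong 5 (Suc N) (partition_fps {i\<in>{1..N}. \<not> 5 dvd i} ^ 2) ?T"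
    unfolding N_def by (rule fps_cong_trans)
  moreover have "int (B 5 n) = fps_nth (partition_fps {i\<in>{1..N}. \<not> 5 dvd i} ^ 2) n"
    by (rule B_conv_partition_fps) (simp add: N_def)
  ultimately have "[int (B 5 n) = fps_nth ?T n] (mod 5)"
    by (simp add: fps_cong_def N_def)
  also have "?T = (\<Sum>(r, s)\<in>?S. fps_const (a r * b s) * fps_X ^ (e r + f s))"
    unfolding sum_product sum.cartesian_product fps_const_mult [symmetric] power_add
    by (intro sum.cong refl) (auto simp: mult_ac)
  also have "fps_nth \<dots> n = (\<Sum>(r, s)\<in>?S. if e r + f s = n then a r * b s else 0)"
    unfolding fps_sum_nth by (intro sum.cong refl) (auto simp: fps_X_power_nth)
  also have "\<dots> = (\<Sum>(r, s)\<in>theta_pairs n. a r * b s)"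
  proof (rule sum.mono_neutral_cong_right)
    show "theta_pairs n \<subseteq> ?S" using theta_pairs_subset[of n] by (auto simp: N_def)
    show "\<forall>x\<in>?S - theta_pairs n. (case x of (r, s) \<Rightarrow> if e r + f s = n then a r * b s else 0) = 0"
      by (auto simp: conv)
    show "(case x of (r, s) \<Rightarrow> if e r + f s = n then a r * b s else 0) = (case x of (r, s) \<Rightarrow> a r * b s)"
      if "x \<in> theta_pairs n" for x
      using that by (cases x) (auto simp: conv)
  qed simp
  also have "\<dots> = (\<Sum>(r, s)\<in>theta_pairs n. (-1) ^ (r + nat \<bar>s\<bar>) * (2 * int r + 1))"
    by (intro sum.cong refl) (auto simp: a_def b_def power_add)
  finally show ?thesis .
qed

section \<open>The form $3x^2 + 5y^2$\<close>

text \<open>Turns congruences between Legendre symbols, such as those from Euler's criterion, into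
  equalities.\<close>

lemma cong_imp_eq_abs_le_1:
  fixes a b m :: int
  assumes "[a = b] (mod m)" "\<bar>a\<bar> \<le> 1" "\<bar>b\<bar> \<le> 1" "m > 2"
  shows "a = b"
proof (rule ccontr)
  assume "a \<noteq> b"
  moreover have "m dvd a - b" using assms(1) by (simp add: cong_iff_dvd_diff)
  ultimately have "\<bar>m\<bar> \<le> \<bar>a - b\<bar>" using dvd_imp_le_int[of "a - b" m] by simp
  then show False using assms(2-4) by linarith
qed

lemma abs_Legendre_le_1: "\<bar>Legendre a p\<bar> \<le> 1"
  by (simp add: Legendre_def)

lemma Legendre_mult:
  assumes "prime p" "p > 2"
  shows "Legendre (a * b) (int p) = Legendre a (int p) * Legendre b (int p)"
proof (rule cong_imp_eq_abs_le_1)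
  have "[Legendre a p * Legendre b p = a ^ ((p - 1) div 2) * b ^ ((p - 1) div 2)] (mod p)"
    using assms by (intro cong_mult euler_criterion)
  with euler_criterion[OF assms, of "a * b"]
  show "[Legendre (a * b) (int p) = Legendre a (int p) * Legendre b (int p)] (mod int p)"
    unfolding power_mult_distrib by (meson cong_sym cong_trans)
qed (use assms in \<open>auto simp: Legendre_def\<close>)

text \<open>As \<open>p\<close> is 1 modulo 3, reciprocity gives 3 the symbol
  \<open>(-1) ^ h\<close>, which cancels the symbol of -1. Reciprocity for 5 involves no sign, since
  (5 - 1) / 2 is even.\<close>

lemma Legendre_minus_15:
  assumes "prime p" "[p = 1] (mod 6)" "p \<noteq> 5"
  shows "Legendre (-15) (int p) = Legendre (int p) 5"
proof -
  have p6: "p mod 6 = 1" using assms(2) by (simp add: cong_def)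
  have p2: "p > 2" using prime_gt_1_nat[OF assms(1)] p6 by (cases "p = 2") auto
  have p3: "p \<noteq> 3" "p mod 3 = 1" using p6 by (auto, presburger)
  define h where "h = (p - 1) div 2"
  have "int p mod 3 = 1" using p3(2) by presburger
  then have "QuadRes 3 (int p)" "\<not> [int p = 0] (mod 3)"
    unfolding QuadRes_def by (auto simp: cong_def intro!: exI[of _ 1])
  then have "Legendre (int p) 3 = 1" by (simp add: Legendre_def)
  then have L3: "Legendre 3 (int p) = (-1) ^ h"
    using Quadratic_Reciprocity[of 3 p] assms(1) p2 p3(1) by (simp add: h_def)
  have "Legendre 5 (int p) * Legendre (int p) 5 = 1"
    using Quadratic_Reciprocity[of 5 p] assms(1,3) p2 by (simp add: h_def mult.commute)
  then have L5: "Legendre 5 (int p) = Legendre (int p) 5"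
    by (auto simp: Legendre_def split: if_splits)
  have "[Legendre (-1) (int p) = (-1) ^ h] (mod p)"
    using euler_criterion[OF assms(1) p2, of "-1"] by (simp add: h_def)
  then have Lm1: "Legendre (-1) (int p) = (-1) ^ h"
    by (rule cong_imp_eq_abs_le_1) (use p2 abs_Legendre_le_1 in \<open>simp_all add: power_abs\<close>)
  have "Legendre (-15) (int p) = Legendre (-1) (int p) * (Legendre 3 (int p) * Legendre 5 (int p))"
    using Legendre_mult[OF assms(1) p2, of "-1" 15] Legendre_mult[OF assms(1) p2, of 3 5] by simp
  also have "\<dots> = Legendre (int p) 5"
    unfolding Lm1 L3 L5 by (simp flip: power_add mult_2 add: mult.assoc [symmetric])
  finally show ?thesis .
qed

lemma QuadRes_5_iff: "QuadRes 5 a \<longleftrightarrow> a mod 5 \<in> {0, 1, 4}"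
proof
  assume "QuadRes 5 a"
  then obtain y where y: "a mod 5 = y ^ 2 mod 5" unfolding QuadRes_def cong_def by metis
  have "y mod 5 \<in> {0, 1, 2, 3, 4}" by auto
  then have "(y mod 5) ^ 2 mod 5 \<in> {0, 1, 4}" by auto
  then show "a mod 5 \<in> {0, 1, 4}" unfolding y by (simp add: power_mod)
next
  assume "a mod 5 \<in> {0, 1, 4}"
  then have "[0 ^ 2 = a] (mod 5) \<or> [1 ^ 2 = a] (mod 5) \<or> [2 ^ 2 = a] (mod 5)"
    by (auto simp: cong_def)
  then show "QuadRes 5 a" unfolding QuadRes_def by blast
qed

lemma QuadRes_minus_15_iff:
  assumes "prime p" "[p = 1] (mod 6)" "p \<noteq> 5"
  shows "QuadRes (int p) (-15) \<longleftrightarrow> int p mod 5 \<in> {1, 4}"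
proof -
  have "p mod 6 = 1" using assms(2) by (simp add: cong_def)
  then have "p \<noteq> 3" by auto
  have "\<not> p dvd 15"
  proof
    assume "p dvd 15"
    then have "p dvd 3 * 5" by simp
    then have "p dvd 3 \<or> p dvd 5" using assms(1) by (simp only: prime_dvd_mult_iff)
    then show False using assms(1,3) \<open>p \<noteq> 3\<close> primes_dvd_imp_eq[of p 3] primes_dvd_imp_eq[of p 5] by auto
  qed
  then have 1: "\<not> [-15 = 0] (mod int p)"
    by (simp add: cong_iff_dvd_diff) (metis int_dvd_int_iff of_nat_numeral)
  have "\<not> 5 dvd p" using assms(1,3) primes_dvd_imp_eq[of 5 p] by auto
  then have 2: "int p mod 5 \<noteq> 0" by presburger
  have "QuadRes (int p) (-15) \<longleftrightarrow> Legendre (-15) (int p) = 1"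
    using 1 by (simp add: Legendre_def)
  also have "\<dots> \<longleftrightarrow> QuadRes 5 (int p)"
    using 2 unfolding Legendre_minus_15[OF assms] by (simp add: Legendre_def cong_def)
  finally show ?thesis using 2 by (simp add: QuadRes_5_iff)
qed

section \<open>Descent when -15 is not a square\<close>

text \<open>If \<open>x\<close> had an inverse \<open>z\<close> modulo \<open>p\<close>, then
  \<open>5 * y * z\<close> would be a square root of -15.\<close>

lemma prime_dvd_3_5_form:
  fixes p :: int
  assumes "prime p" "p \<noteq> 3" "p \<noteq> 5" "\<not> QuadRes p (-15)" "p dvd 3 * x ^ 2 + 5 * y ^ 2"
  shows "p dvd x \<and> p dvd y"
proof -
  have px: "p dvd x"
  proof (rule ccontr)
    assume "\<not> p dvd x"
    then have "coprime x p" using assms(1) by (simp add: prime_imp_coprime coprime_commute)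
    then obtain z where z: "[x * z = 1] (mod p)" using cong_solve_coprime_int by blast
    have "[(5 * y * z) ^ 2 = (5 * y * z) ^ 2 - 5 * z ^ 2 * (3 * x ^ 2 + 5 * y ^ 2)] (mod p)"
      using assms(5) by (simp add: cong_iff_dvd_diff)
    also have "(5 * y * z) ^ 2 - 5 * z ^ 2 * (3 * x ^ 2 + 5 * y ^ 2) = -15 * (x * z) ^ 2"
      by (simp add: power2_eq_square algebra_simps)
    also have "[-15 * (x * z) ^ 2 = -15 * 1 ^ 2] (mod p)"
      by (intro cong_mult cong_pow cong_refl z)
    finally show False using assms(4) by (auto simp: QuadRes_def)
  qed
  then have "p dvd 3 * x ^ 2" by (simp add: power2_eq_square)
  then have "p dvd 5 * y ^ 2" using assms(5) by (simp add: dvd_add_right_iff)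
  moreover have "\<not> p dvd 5" using assms(1,3) primes_dvd_imp_eq[of p 5] by auto
  ultimately have "p dvd y" using assms(1) by (metis prime_dvd_mult_iff prime_dvd_power_iff zero_less_numeral)
  with px show ?thesis ..
qed

text \<open>Descent: \<open>p\<close> divides both \<open>x\<close> and \<open>y\<close>, so
  \<open>p ^ 2\<close> cancels and \<open>k\<close> drops by one. At \<open>k = 0\<close> this
  leaves \<open>p\<close> dividing \<open>m\<close>.\<close>

lemma odd_prime_power_not_3_5_form:
  fixes p :: int
  assumes "prime p" "p \<noteq> 3" "p \<noteq> 5" "\<not> QuadRes p (-15)" "\<not> p dvd m"
  shows "3 * x ^ 2 + 5 * y ^ 2 \<noteq> p ^ (2 * k + 1) * m"
proof (induction k arbitrary: x y)
  case (0 x y)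
  show ?case
  proof
    assume eq: "3 * x ^ 2 + 5 * y ^ 2 = p ^ (2 * 0 + 1) * m"
    then have "p dvd x" "p dvd y" using prime_dvd_3_5_form[OF assms(1-4), of x y] by auto
    then obtain a b where "x = p * a" "y = p * b" by (auto elim!: dvdE)
    with eq have "p * (p * (3 * a ^ 2 + 5 * b ^ 2)) = p * m" by (simp add: power2_eq_square algebra_simps)
    then have "p * (3 * a ^ 2 + 5 * b ^ 2) = m" using assms(1) by simp
    then show False using assms(5) by auto
  qed
next
  case (Suc k x y)
  show ?case
  proof
    assume eq: "3 * x ^ 2 + 5 * y ^ 2 = p ^ (2 * Suc k + 1) * m"
    then have "p dvd x" "p dvd y" using prime_dvd_3_5_form[OF assms(1-4), of x y] by auto
    then obtain a b where "x = p * a" "y = p * b" by (auto elim!: dvdE)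
    with eq have "p ^ 2 * (3 * a ^ 2 + 5 * b ^ 2) = p ^ 2 * (p ^ (2 * k + 1) * m)"
      by (simp add: power2_eq_square algebra_simps)
    then have "3 * a ^ 2 + 5 * b ^ 2 = p ^ (2 * k + 1) * m" using assms(1) by simp
    then show False using Suc.IH by blast
  qed
qed

section \<open>Representing primes by u^2 + 15 v^2\<close>

text \<open>Thue's lemma by pigeonhole: with \<open>s = floor_sqrt p\<close> there are (s + 1)^2 > p
  pairs, so two of them agree modulo \<open>p\<close>, and their difference is the required pair.
  The bounds are strict because a prime is not a square.\<close>

lemma thue:
  fixes p :: nat and a :: int
  assumes "prime p"
  obtains x y where "(x, y) \<noteq> (0, 0)" "x ^ 2 < int p" "y ^ 2 < int p" "int p dvd x - a * y"
proof -
  define s where "s = floor_sqrt p"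
  define f where "f = (\<lambda>(x, y). (x - a * y) mod int p)"
  let ?S = "{0..int s} \<times> {0..int s}"
  have "p < (Suc s) ^ 2" unfolding s_def by (rule Suc_floor_sqrt_power2_gt)
  then have "p < card ?S" by (simp add: power2_eq_square nat_add_distrib)
  moreover have "f ` ?S \<subseteq> {0..<int p}" using prime_gt_0_nat[OF assms] by (auto simp: f_def)
  then have "card (f ` ?S) \<le> p" using card_mono[of "{0..<int p}" "f ` ?S"] by simp
  ultimately have "\<not> inj_on f ?S" by (intro pigeonhole) simp
  then obtain x1 y1 x2 y2 where xy: "(x1, y1) \<in> ?S" "(x2, y2) \<in> ?S" "(x1, y1) \<noteq> (x2, y2)" "f (x1, y1) = f (x2, y2)"
    unfolding inj_on_def by auto
  have "s ^ 2 \<le> p" unfolding s_def by (rule floor_sqrt_power2_le)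
  moreover have "s ^ 2 \<noteq> p"
  proof
    assume eq: "s ^ 2 = p"
    then have "s dvd p" by auto
    then have "s = 1 \<or> s = p" using assms by (auto simp: prime_nat_iff)
    then show False using eq prime_gt_1_nat[OF assms] by (auto simp: power2_eq_square)
  qed
  ultimately have s: "int s ^ 2 < int p" by (metis le_neq_implies_less of_nat_less_iff of_nat_power)
  have sq: "z ^ 2 < int p" if "\<bar>z\<bar> \<le> int s" for z
    using le_less_trans[OF power_mono[OF that, of 2] s] by simp
  show ?thesis
  proof (rule that[of "x1 - x2" "y1 - y2"])
    show "(x1 - x2, y1 - y2) \<noteq> (0, 0)" using xy by auto
    show "(x1 - x2) ^ 2 < int p" "(y1 - y2) ^ 2 < int p" using xy by (auto intro!: sq)
    have "[x1 - a * y1 = x2 - a * y2] (mod int p)" using xy(4) by (simp add: f_def cong_def)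
    then show "int p dvd x1 - x2 - a * (y1 - y2)" by (simp add: cong_iff_dvd_diff algebra_simps)
  qed
qed

text \<open>Thue's lemma is applied to a third of a square root of -15, which gives 3 x^2 + 5 y^2 =
  k p with 0 < k < 8. Congruences leave only k = 3 and k = 5; then 3 divides \<open>y\<close> or 5
  divides \<open>x\<close>, and dividing by k gives the form u^2 + 15 v^2.\<close>

lemma prime_eq_u2_15v2:
  assumes "prime p" "[p = 1] (mod 6)" "int p mod 5 \<in> {1, 4}"
  obtains u v where "int p = u ^ 2 + 15 * v ^ 2" "[u = 1] (mod 3)"
proof -
  have p6: "p mod 6 = 1" using assms(2) by (simp add: cong_def)
  have p2: "odd (int p)" and p3: "int p mod 3 = 1" using p6 by presburger+
  have p5: "p \<noteq> 5" using p6 by auto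
  have p0: "int p > 0" using prime_gt_0_nat[OF assms(1)] by simp
  have pr: "prime (int p)" using assms(1) by simp
  have n3: "\<not> int p dvd 3" using pr p3 primes_dvd_imp_eq[of "int p" 3] by auto
  obtain a where a: "[a ^ 2 = -15] (mod int p)"
    using QuadRes_minus_15_iff[OF assms(1,2) p5] assms(3) by (auto simp: QuadRes_def)
  have "coprime 3 (int p)" using n3 pr by (simp add: prime_imp_coprime coprime_commute)
  then obtain i where i: "[3 * i = 1] (mod int p)" using cong_solve_coprime_int by blast
  obtain x y where xy: "(x, y) \<noteq> (0, 0)" "x ^ 2 < int p" "y ^ 2 < int p" "int p dvd x - (a * i) * y"
    by (rule thue[OF assms(1), of "a * i"])
  have "[3 * x = 3 * (a * i * y)] (mod int p)"
    using xy(4) by (intro cong_mult cong_refl) (simp add: cong_iff_dvd_diff)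
  also have "3 * (a * i * y) = (3 * i) * (a * y)" by simp
  also have "[(3 * i) * (a * y) = 1 * (a * y)] (mod int p)" by (intro cong_mult cong_refl i)
  finally have "[(3 * x) ^ 2 = (1 * (a * y)) ^ 2] (mod int p)" by (rule cong_pow)
  also have "(1 * (a * y)) ^ 2 = a ^ 2 * y ^ 2" by (simp add: power_mult_distrib)
  also have "[a ^ 2 * y ^ 2 = -15 * y ^ 2] (mod int p)" by (intro cong_mult cong_refl a)
  finally have "int p dvd 3 * (3 * x ^ 2 + 5 * y ^ 2)" by (simp add: cong_iff_dvd_diff power2_eq_square algebra_simps)
  then have "int p dvd 3 * x ^ 2 + 5 * y ^ 2" using n3 pr by (auto simp only: prime_dvd_mult_iff)
  then obtain k where k: "3 * x ^ 2 + 5 * y ^ 2 = int p * k" by (auto elim!: dvdE)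
  have "0 < 3 * x ^ 2 + 5 * y ^ 2"
    using xy(1) by (cases "x = 0") (auto simp: add_pos_nonneg)
  then have "k > 0" using k p0 by (simp add: zero_less_mult_iff)
  have "int p * k < int p * 8" using k xy(2,3) by linarith
  then have "k < 8" using p0 by simp
  have m3: "z ^ 2 mod 3 \<in> {0, 1}" for z :: int
  proof -
    have "z mod 3 \<in> {0, 1, 2}" by auto
    then have "(z mod 3) ^ 2 mod 3 \<in> {0, 1}" by auto
    then show ?thesis by (simp add: power_mod)
  qed
  have m5: "z ^ 2 mod 5 \<in> {0, 1, 4}" for z :: int
    using QuadRes_5_iff[of "z ^ 2"] unfolding QuadRes_def by (meson cong_refl)
  \<comment> \<open>Modulo 3, where \<open>p\<close> is 1, \<open>k\<close> is twice a square; this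
    excludes 1, 4 and 7.\<close>
  have "k mod 3 = (3 * x ^ 2 + 5 * y ^ 2) mod 3"
    unfolding k by (simp add: p3 mod_mult_left_eq [of "int p", symmetric])
  also have "\<dots> = 2 * (y ^ 2 mod 3) mod 3"
    by (simp add: mod_mult_right_eq mod_add_eq [symmetric] flip: mod_mult_left_eq [of 5])
  finally have "k mod 3 \<noteq> 1" using m3[of y] by auto
  then have "k \<noteq> 1 \<and> k \<noteq> 4 \<and> k \<noteq> 7" by auto
  \<comment> \<open>For \<open>k = 6\<close>, x^2 would be 2 p modulo 5, hence 2 or 3, which are not
    squares.\<close>
  moreover have "k \<noteq> 6"
  proof
    assume "k = 6"
    then have "x ^ 2 = 2 * int p + 5 * (2 * int p - 2 * y ^ 2 - x ^ 2)" using k by simp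
    then have "x ^ 2 mod 5 = 2 * int p mod 5" by (metis mod_mult_self2)
    also have "\<dots> = 2 * (int p mod 5) mod 5" by (simp add: mod_mult_right_eq)
    finally show False using m5[of x] assms(3) by auto
  qed
  \<comment> \<open>For \<open>k = 2\<close>, \<open>x\<close> and \<open>y\<close> have equal
    parity, so 4 divides the form but not 2 p.\<close>
  moreover have "k \<noteq> 2"
  proof
    assume "k = 2"
    then have eq: "3 * x ^ 2 + 5 * y ^ 2 = 2 * int p" using k by simp
    then have "even (3 * x ^ 2 + 5 * y ^ 2)" by simp
    then have "even x \<longleftrightarrow> even y" by simp
    then have "even (x - y)" by simp
    then obtain c where "x - y = 2 * c" by (elim evenE)
    then have "x = y + 2 * c" by simp
    then have "4 * (2 * y ^ 2 + 3 * y * c + 3 * c ^ 2) = 2 * int p"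
      using eq by (simp add: power2_eq_square algebra_simps)
    then show False using p2 by presburger
  qed
  ultimately have "k = 3 \<or> k = 5" using \<open>k > 0\<close> \<open>k < 8\<close> by linarith
  then have "\<exists>u v. int p = u ^ 2 + 15 * v ^ 2"
  proof
    assume "k = 3"
    then have "3 dvd y ^ 2" using k by presburger
    then have "3 dvd y" using prime_dvd_power[of 3 y 2] by simp
    then obtain c where "y = 3 * c" by (elim dvdE)
    then have "int p = x ^ 2 + 15 * c ^ 2" using k \<open>k = 3\<close> by (simp add: power2_eq_square)
    then show ?thesis by blast
  next
    assume "k = 5"
    then have "5 dvd x ^ 2" using k by presburger
    then have "5 dvd x" using prime_dvd_power[of 5 x 2] by simp
    then obtain c where "x = 5 * c" by (elim dvdE)
    then have "int p = y ^ 2 + 15 * c ^ 2" using k \<open>k = 5\<close> by (simp add: power2_eq_square)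
    then show ?thesis by blast
  qed
  then obtain u v where uv: "int p = u ^ 2 + 15 * v ^ 2" by blast
  \<comment> \<open>Replacing \<open>u\<close> by \<open>- u\<close> if necessary makes it 1 modulo
    3.\<close>
  have "u mod 3 \<noteq> 0"
  proof
    assume "u mod 3 = 0"
    then obtain c where "u = 3 * c" by (meson dvd_def mod_0_imp_dvd)
    then have "int p = 3 * (3 * c ^ 2 + 5 * v ^ 2)" using uv by (simp add: power2_eq_square)
    then show False using p3 by simp
  qed
  then have "[u = 1] (mod 3) \<or> [- u = 1] (mod 3)" unfolding cong_def by presburger
  then show ?thesis using that[of u v] that[of "- u" v] uv by auto
qed

section \<open>The solutions attached to a prime and their weights\<close>

text \<open>Determines each solution up to two signs. The normalization of \<open>u\<close> modulo 3
  fixes the sign of \<open>Y\<close>, and \<open>X\<close> equals the sign of the weight; the weight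
  is therefore X (u X + 5 w), which is \<open>u\<close> modulo 5.\<close>

lemma theta_pairs_prime:
  fixes u v :: int
  assumes p: "prime p" "p \<noteq> 5" "3 * n + 1 = p" and uv: "int p = u ^ 2 + 15 * v ^ 2" "[u = 1] (mod 3)"
    and rs: "(r, s) \<in> theta_pairs n"
  obtains w X where "w \<in> {v, - v}" "X \<in> {1, - 1}" "2 * int r + 1 = u * X + 5 * w" "6 * s - 1 = - u + 3 * w * X"
    "(-1) ^ (r + nat \<bar>s\<bar>) = X"
proof -
  define x y where "x = 2 * int r + 1" and "y = 6 * s - 1"
  have xy: "3 * x ^ 2 + 5 * y ^ 2 = 8 * int p"
    using rs p(3) by (auto simp: theta_pairs_def x_def y_def)
  have pr: "prime (int p)" and p0: "int p > 0" using p(1) prime_gt_0_nat by auto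
  have "p \<noteq> 3" using p(3) by presburger
  then have "\<not> p dvd 5" "\<not> p dvd 3"
    using p(1,2) primes_dvd_imp_eq[of p 5] primes_dvd_imp_eq[of p 3] by auto
  then have n35: "\<not> int p dvd 5" "\<not> int p dvd 3"
    by (metis int_dvd_int_iff of_nat_numeral)+
  \<comment> \<open>One of \<open>u \<plusminus> v\<surd>-15\<close> divides \<open>x\<surd>3 + y\<surd>-5\<close>; the quotient \<open>X\<surd>3 + Y\<surd>-5\<close> has norm 8.\<close>
  have "5 * (u * y - 3 * v * x) * (u * y + 3 * v * x) = u ^ 2 * (3 * x ^ 2 + 5 * y ^ 2) - 3 * x ^ 2 * (u ^ 2 + 15 * v ^ 2)"
    by (simp add: power2_eq_square algebra_simps)
  also have "\<dots> = int p * (8 * u ^ 2 - 3 * x ^ 2)"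
    unfolding xy uv(1) [symmetric] by (simp add: algebra_simps)
  finally have "int p dvd 5 * (u * y - 3 * v * x) * (u * y + 3 * v * x)" by simp
  then have "int p dvd u * y - 3 * v * x \<or> int p dvd u * y - 3 * (- v) * x"
    using n35 unfolding prime_dvd_mult_iff[OF pr] by auto
  then obtain w where w: "w \<in> {v, - v}" "int p dvd u * y - 3 * w * x" by blast
  then obtain Y where Y: "u * y - 3 * w * x = int p * Y" by (auto elim!: dvdE)
  have uw: "int p = u ^ 2 + 15 * w ^ 2" using uv(1) w(1) by auto
  \<comment> \<open>Multiplicativity of the norm; it shows that \<open>p\<close> divides the other
    coordinate as well.\<close>
  have "3 * (u * x + 5 * w * y) ^ 2 + 5 * (u * y - 3 * w * x) ^ 2 = (u ^ 2 + 15 * w ^ 2) * (3 * x ^ 2 + 5 * y ^ 2)"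
    by (simp add: power2_eq_square algebra_simps)
  then have eq: "3 * (u * x + 5 * w * y) ^ 2 + 5 * (int p * Y) ^ 2 = int p * (8 * int p)"
    unfolding xy Y uw [symmetric] .
  then have "3 * (u * x + 5 * w * y) ^ 2 = int p * (8 * int p - 5 * int p * Y ^ 2)"
    by (simp add: power2_eq_square algebra_simps)
  then have "int p dvd 3 * (u * x + 5 * w * y) ^ 2" by simp
  then have "int p dvd u * x + 5 * w * y"
    using n35 pr by (auto simp: prime_dvd_mult_iff prime_dvd_power_iff)
  then obtain X where X: "u * x + 5 * w * y = int p * X" by (auto elim!: dvdE)
  have "int p ^ 2 * (3 * X ^ 2 + 5 * Y ^ 2) = int p ^ 2 * 8"
    using eq unfolding X by (simp add: power2_eq_square algebra_simps)
  then have XY: "3 * X ^ 2 + 5 * Y ^ 2 = 8" using p0 by simp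
  have abs1: "z \<in> {-1, 0, 1}" if "z ^ 2 < 4" for z :: int
    using power2_less_imp_less[of "\<bar>z\<bar>" 2] that by auto
  have "X \<in> {-1, 0, 1}" "Y \<in> {-1, 0, 1}"
    using XY zero_le_power2[of X] zero_le_power2[of Y] by (intro abs1; linarith)+
  with XY have X1: "X \<in> {1, -1}" and Y1: "Y \<in> {1, -1}" by auto
  have "int p * x = u * (u * x + 5 * w * y) - 5 * w * (u * y - 3 * w * x)"
    unfolding uw by (simp add: power2_eq_square algebra_simps)
  also have "\<dots> = int p * (u * X - 5 * w * Y)" unfolding X Y by (simp add: algebra_simps)
  finally have x: "x = u * X - 5 * w * Y" using p0 by simp
  have "int p * y = u * (u * y - 3 * w * x) + 3 * w * (u * x + 5 * w * y)"
    unfolding uw by (simp add: power2_eq_square algebra_simps)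
  also have "\<dots> = int p * (u * Y + 3 * w * X)" unfolding X Y by (simp add: algebra_simps)
  finally have y: "y = u * Y + 3 * w * X" using p0 by simp
  obtain c where c: "u = 3 * c + 1" using uv(2) by (metis cong_iff_lin cong_sym add.commute)
  \<comment> \<open>\<open>Y = 1\<close> would give 6 s - 1 the residue 1 modulo 3, because
    \<open>u\<close> has it.\<close>
  have "Y \<noteq> 1"
  proof
    assume "Y = 1"
    then have "6 * s - 1 = 3 * c + 1 + 3 * (w * X)" using y c by (simp add: y_def)
    then show False by presburger
  qed
  then have Y: "Y = -1" using Y1 by auto
  have odd: "odd (u + w)"
  proof -
    have "odd (int p)"
      using xy prime_odd_nat[OF p(1)] prime_ge_2_nat[OF p(1)] p(3) by (cases "p = 2") auto
    then show ?thesis using uw by simp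
  qed
  then obtain t where t: "w = 2 * t + 1 - u" by (metis oddE add.commute add_diff_cancel)
  \<comment> \<open>Since x y + 1 = 12 r s + 2 (3 s - r), the residue of x y modulo 4 decides the
    parity of 3 s - r, which is that of r + s. It is computed from the opposite parities of
    \<open>u\<close> and \<open>w\<close>.\<close>
  have "x * y = (u * X + 5 * w) * (- u + 3 * w * X)" using x y Y by simp
  then have prod: "(2 * int r + 1) * (6 * s - 1) = - (u ^ 2) * X + 3 * u * w * (X * X) - 5 * u * w + 15 * w ^ 2 * X"
    by (simp add: x_def y_def power2_eq_square algebra_simps)
  have par: "even (r + nat \<bar>s\<bar>) \<longleftrightarrow> even (3 * s - int r)" by (auto simp: even_nat_iff)
  have sign: "(-1) ^ (r + nat \<bar>s\<bar>) = X"
  proof (cases "X = 1")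
    case True
    have "6 * s - 2 * int r = 4 * (4 * w ^ 2 - t ^ 2 - t - 3 * int r * s)"
      using prod True by (simp add: t power2_eq_square algebra_simps)
    then have "3 * s - int r = 2 * (4 * w ^ 2 - t ^ 2 - t - 3 * int r * s)" by simp
    then have "even (3 * s - int r)" by simp
    then show ?thesis using par True by simp
  next
    case False
    then have X: "X = -1" using X1 by simp
    define t' where "t' = t - w"
    have u: "u = 2 * t' + 1 + w" using t by (simp add: t'_def)
    have "6 * s - 2 * int r = 4 * (t' ^ 2 + t' - 4 * w ^ 2 - 3 * int r * s) + 2"
      using prod X by (simp add: u power2_eq_square algebra_simps)
    then have "3 * s - int r = 2 * (t' ^ 2 + t' - 4 * w ^ 2 - 3 * int r * s) + 1" by simp
    then have "odd (3 * s - int r)" by simp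
    then show ?thesis using par X by simp
  qed
  show ?thesis
    using that[of w X] w(1) X1 x y Y sign by (simp add: x_def y_def)
qed

text \<open>The solution comes from \<open>w = v\<close> with x = |u + 5 v| and y = 3 v - u. It has
  the required shape because u + v is odd and \<open>u\<close> is 1 modulo 3.\<close>

lemma theta_pairs_prime_nonempty:
  fixes u v :: int
  assumes p: "prime p" "odd p" "3 * n + 1 = p" and uv: "int p = u ^ 2 + 15 * v ^ 2" "[u = 1] (mod 3)"
  shows "theta_pairs n \<noteq> {}"
proof -
  have "odd (int p)" using p(2) by simp
  then have odd: "odd (u + v)" using uv(1) by simp
  obtain c where c: "u = 3 * c + 1" using uv(2) by (metis cong_iff_lin cong_sym add.commute)
  define r where "r = nat ((\<bar>u + 5 * v\<bar> - 1) div 2)"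
  have "odd \<bar>u + 5 * v\<bar>" using odd by simp
  then obtain t where t: "\<bar>u + 5 * v\<bar> = 2 * t + 1" by (elim oddE)
  moreover have "t \<ge> 0" using t abs_ge_zero[of "u + 5 * v"] by linarith
  ultimately have r: "2 * int r + 1 = \<bar>u + 5 * v\<bar>" by (simp add: r_def)
  have "6 dvd - u + 3 * v + 1" using odd unfolding c by presburger
  then obtain s where s: "- u + 3 * v + 1 = 6 * s" by (elim dvdE)
  then have s': "6 * s - 1 = - u + 3 * v" by simp
  have "3 * (2 * int r + 1) ^ 2 + 5 * (6 * s - 1) ^ 2 = 8 * int p"
    unfolding r s' uv(1) by (simp add: power2_eq_square algebra_simps)
  then have "(r, s) \<in> theta_pairs n" using p(3) by (auto simp: theta_pairs_def)
  then show ?thesis by blast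
qed

text \<open>All weights are \<open>u\<close> modulo 5, so the sum is \<open>card ?T * u\<close>.
  There are one or two solutions, and 5 does not divide \<open>u\<close>, as it does not divide
  \<open>p\<close>.\<close>

lemma B_5_not_cong_0:
  assumes "prime p" "[p = 1] (mod 6)" "int p mod 5 \<in> {1, 4}"
  shows "\<not> [B 5 ((p - 1) div 3) = 0] (mod 5)"
proof
  assume B0: "[B 5 ((p - 1) div 3) = 0] (mod 5)"
  define n where "n = (p - 1) div 3"
  have p6: "p mod 6 = 1" using assms(2) by (simp add: cong_def)
  then have n: "3 * n + 1 = p" and odd: "odd p" and p5: "p \<noteq> 5"
    unfolding n_def by presburger+
  obtain u v where uv: "int p = u ^ 2 + 15 * v ^ 2" "[u = 1] (mod 3)"
    by (rule prime_eq_u2_15v2[OF assms])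
  note sol = theta_pairs_prime[OF assms(1) p5 n uv]
  let ?T = "theta_pairs n"
  have weight: "[(-1) ^ (r + nat \<bar>s\<bar>) * (2 * int r + 1) = u] (mod 5)" if rs: "(r, s) \<in> ?T" for r s
  proof -
    obtain w X where "w \<in> {v, - v}" "X \<in> {1, - 1}" "2 * int r + 1 = u * X + 5 * w"
      "6 * s - 1 = - u + 3 * w * X" "(-1) ^ (r + nat \<bar>s\<bar>) = X"
      by (rule sol[OF rs])
    then show ?thesis by (auto simp: cong_iff_dvd_diff algebra_simps)
  qed
  have "[int (B 5 n) = (\<Sum>(r, s)\<in>?T. (-1) ^ (r + nat \<bar>s\<bar>) * (2 * int r + 1))] (mod 5)"
    by (rule B_5_cong)
  also have "[(\<Sum>(r, s)\<in>?T. (-1) ^ (r + nat \<bar>s\<bar>) * (2 * int r + 1)) = (\<Sum>x\<in>?T. u)] (mod 5)"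
    using weight by (intro cong_sum) auto
  finally have "[int (B 5 n) = int (card ?T) * u] (mod 5)" by simp
  moreover have "[int (B 5 n) = int 0] (mod int 5)" using B0 unfolding n_def by (simp only: cong_int_iff)
  ultimately have "5 dvd int (card ?T) * u"
    by (metis cong_0_iff cong_sym cong_trans of_nat_0 of_nat_numeral)
  moreover have "\<not> 5 dvd u"
  proof
    assume "5 dvd u"
    then obtain c where "u = 5 * c" by (elim dvdE)
    then have "int p = 5 * (5 * c ^ 2 + 3 * v ^ 2)" using uv(1) by (simp add: power2_eq_square)
    then show False using assms(3) by auto
  qed
  \<comment> \<open>\<open>r \<ge> 0\<close> is determined by \<open>s\<close>, and \<open>s\<close>
    by \<open>w * X\<close>, which is \<open>v\<close> or \<open>- v\<close>.\<close>
  moreover have "card ?T \<le> 2"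
  proof -
    have "inj_on snd ?T"
    proof (rule inj_onI, clarify)
      fix r s r' s' assume "(r, s) \<in> ?T" "(r', s') \<in> ?T" "snd (r, s) = snd (r', s')"
      then have s: "s = s'" and "3 * (2 * int r + 1) ^ 2 + 5 * (6 * s - 1) ^ 2 = 8 * (3 * int n + 1)"
        "3 * (2 * int r' + 1) ^ 2 + 5 * (6 * s' - 1) ^ 2 = 8 * (3 * int n + 1)"
        by (simp_all only: theta_pairs_def mem_Collect_eq prod.case snd_conv)
      then have "(2 * int r + 1) ^ 2 = (2 * int r' + 1) ^ 2" unfolding s by linarith
      then have "2 * int r + 1 = 2 * int r' + 1" by (rule power2_eq_imp_eq) auto
      with s show "r = r' \<and> s = s'" by simp
    qed
    moreover have "snd ` ?T \<subseteq> {(1 - u + 3 * v) div 6, (1 - u - 3 * v) div 6}"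
    proof (rule image_subsetI)
      fix x assume "x \<in> ?T"
      moreover obtain r s where x: "x = (r, s)" by (cases x)
      ultimately have rs: "(r, s) \<in> ?T" by simp
      obtain w X where "w \<in> {v, - v}" "X \<in> {1, - 1}" "2 * int r + 1 = u * X + 5 * w"
        "6 * s - 1 = - u + 3 * w * X" "(-1) ^ (r + nat \<bar>s\<bar>) = X"
        by (rule sol[OF rs])
      then have "6 * s = 1 - u + 3 * v \<or> 6 * s = 1 - u - 3 * v" by auto
      then show "snd x \<in> {(1 - u + 3 * v) div 6, (1 - u - 3 * v) div 6}" unfolding x by auto
    qed
    ultimately have "card ?T \<le> card {(1 - u + 3 * v) div 6, (1 - u - 3 * v) div 6}"
      by (intro card_inj_on_le) auto
    also have "\<dots> \<le> 2" by (simp add: card_insert_if)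
    finally show ?thesis .
  qed
  moreover have "card ?T > 0"
    using theta_pairs_prime_nonempty[OF assms(1) odd n uv] finite_theta_pairs[of n] by (simp add: card_gt_0_iff)
  moreover have "prime (5 :: int)" by simp
  ultimately show False
    using zdvd_imp_le[of 5 "int (card ?T)"] by (simp add: prime_dvd_mult_iff)
qed

section \<open>Transfer to odd powers of the prime\<close>

theorem theorem1p10:
  fixes k p :: nat
  assumes "prime p" and "[p = 1] (mod 6)"
    and "[B 5 ((p - 1) div 3) = 0] (mod 5)"
  shows "\<forall>n::nat. \<not> p dvd (3 * n + 1) \<longrightarrow>
           [B 5 (p ^ (2 * k + 1) * n + (p ^ (2 * k + 1) - 1) div 3) = 0] (mod 5)"
proof (intro allI impI)
  fix n :: nat assume n: "\<not> p dvd 3 * n + 1"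
  define P where "P = p ^ (2 * k + 1)"
  define m where "m = P * n + (P - 1) div 3"
  have p6: "p mod 6 = 1" using assms(2) by (simp add: cong_def)
  then have p35: "p \<noteq> 3" "p \<noteq> 5" by auto
  have "p mod 3 = 1" using p6 by presburger
  then have "P mod 3 = 1" unfolding P_def by (metis mod_less one_less_numeral_iff power_mod power_one semiring_norm(77))
  then have "3 * ((P - 1) div 3) + 1 = P" by presburger
  then have m: "3 * m + 1 = P * (3 * n + 1)" unfolding m_def by (simp add: algebra_simps)
  \<comment> \<open>The hypothesis on \<open>B\<close> excludes \<open>p\<close> being 1 or 4 modulo
    5, the case in which -15 is a square.\<close>
  have "\<not> QuadRes (int p) (-15)"
    using B_5_not_cong_0[OF assms(1,2)] assms(3) QuadRes_minus_15_iff[OF assms(1,2) p35(2)] by blast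
  moreover have "prime (int p)" "int p \<noteq> 3" "int p \<noteq> 5" using assms(1) p35 by auto
  \<comment> \<open>As 3 m + 1 = P (3 n + 1), this makes \<open>2 * k + 1\<close> the exact exponent
    of \<open>p\<close> in 8 (3 m + 1), which is odd.\<close>
  moreover have "\<not> int p dvd 8 * (3 * int n + 1)"
  proof
    assume "int p dvd 8 * (3 * int n + 1)"
    then have "int p dvd int (8 * (3 * n + 1))" by (simp add: algebra_simps)
    then have "p dvd 2 ^ 3 * (3 * n + 1)" by (simp only: int_dvd_int_iff) simp
    then have "p dvd 2" using n assms(1) by (metis prime_dvd_mult_iff prime_dvd_power)
    then show False using p6 assms(1) primes_dvd_imp_eq[of p 2] by auto
  qed
  ultimately have no: "3 * x ^ 2 + 5 * y ^ 2 \<noteq> int p ^ (2 * k + 1) * (8 * (3 * int n + 1))" for x y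
    by - (rule odd_prime_power_not_3_5_form)
  have "theta_pairs m = {}"
  proof -
    have "int P = int p ^ (2 * k + 1)" by (simp add: P_def)
    moreover have "3 * int m + 1 = int P * (3 * int n + 1)" using m by (metis of_nat_1 of_nat_add of_nat_mult of_nat_numeral)
    ultimately have "8 * (3 * int m + 1) = int p ^ (2 * k + 1) * (8 * (3 * int n + 1))" by simp
    then show ?thesis using no by (auto simp only: theta_pairs_def)
  qed
  then have "[int (B 5 m) = int 0] (mod int 5)" using B_5_cong[of m] by simp
  then show "[B 5 (p ^ (2 * k + 1) * n + (p ^ (2 * k + 1) - 1) div 3) = 0] (mod 5)"
    unfolding m_def P_def by (simp only: cong_int_iff)
qed

end
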